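(* Let $(T=V/\Lambda,\omega)$ be a linear symplectic torus, and let $(C,\nabla)$ be a linear coisotropic brane in $(T,\omega)$ (possibly a Lagrangian brane), together with a choice of a function $\xi$ as in the definition of the lift. Let $\boldsymbol{C}\subset T\times T^\vee$ be its lift to the twisted doubling torus. Then: (1) $\boldsymbol{C}$ is a Lagrangian submanifold of $T\times T^\vee$ with respect to the symplectic form $\frac12\omega\oplus-\frac12\omega^{-1}$. (2) $\boldsymbol{C}$ is a complex submanifold of $T\times T^\vee$ with respect to the canonical complex structure $J=\begin{pmatrix}0&\omega^{-1}\\-\omega&0\end{pmatrix}$.
   Context: **Torus and dual.** $V$ is a real vector space of dimension $2n$, $\Lambda\subset V$ a full lattice, $\omega$ a constant symplectic form on $T=V/\Lambda$; there is no B-field. A 2-form $\beta$ on a vector space $W$ is also viewed as the map $W\to W^\vee$, $u\mapsto\iota_u\beta=\beta(u,\cdot)$; in particular $\omega:V\to V^\vee$ is an isomorphism with inverse $\omega^{-1}:V^\vee\to V$. The dual torus is $T^\vee=V^\vee/\Lambda^\vee$ with $\Lambda^\vee=\mathrm{Hom}(\Lambda,\mathbb Z)$, with symplectic form $-\omega^{-1}$ defined by $-\omega^{-1}(\alpha,\beta):=\alpha(\omega^{-1}\beta)$ for $\alpha,\beta\in V^\vee$. For $\hat x\in T^\vee$ and $\gamma\in\Lambda=H_1(T;\mathbb Z)$ write $\langle\hat x,\gamma\rangle=e^{2\pi i\hat x(\gamma)}\in U(1)$. **Twisted doubling torus.** It is $T\times T^\vee$ with symplectic form $\frac12\omega\oplus-\frac12\omega^{-1}$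 and B-field $\sigma_0=\sum_j\frac12dx_j\wedge d\hat x_j$, where $x_j$ are linear coordinates on $T$ and $\hat x_j$ the dual coordinates on $T^\vee$. The matrix of $J$ is written with respect to $V\oplus V^\vee$, i.e. $J(u+f)=\omega^{-1}f-\omega u$ for $u\in V$, $f\in V^\vee$. **Linear coisotropic brane.** A pair $(C,\nabla)$ where $C\subset T$ is an affine subtorus (a translate of a compact connected subtorus) that is coisotropic for $\omega$, and $\nabla$ is a unitary connection on a complex line bundle over $C$ with translation-invariant curvature $-2\pi iF$, such that, with $TC_{iso}=\ker(\omega|_C)\subset TC$: (1) $F:TC\to T^*C$ vanishes on $TC_{iso}$; (2) $\omega^{-1}F$ defines a complex structure on $TC_{red}=TC/TC_{iso}$, equivalently $\omega+F\omega^{-1}F=0$ on $TC$ (where $\omega^{-1}$ is the inverse of the form induced by $\omega$ on $TC_{red}$). If $C$ is Lagrangian then $TC_{iso}=TC$ and the conditions say $F=0$. **Lift.** Let $\xi:H_1(C;\mathbb Z)\to\mathbb Z/2$ be a function with $\xi(\gamma+\gamma')-\xi(\gamma)-\xi(\gamma')=c_1(\nabla)(\gamma\wedge\gamma')\bmod 2$. For $x\in C$ and $\gamma\in\pi_1(C,x)\cong H_1(C;\mathbb Z)\subset\Lambda$, let $\gamma_x$ be the linear loop through $x$ in $C$ in the class $\gamma$, and $hol_\nabla(\gamma_x)\in U(1)$ its holonomy (for $\nabla=d+A$, $hol_\nabla(\gamma_x)=e^{-\int_{\gamma_x}A}$). Then $\gamma\mapsto(-1)^{\xi(\gamma)}hol_\nabla(\gamma_x)$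 is a homomorphism. The lift is $$\boldsymbol{C}=\{(x,\hat x)\in T\times T^\vee:\ x\in C,\ \langle\hat x,\gamma\rangle=(-1)^{\xi(\gamma)}hol_\nabla(\gamma_x)\ \text{ for all }\gamma\in\pi_1(C,x)\},$$ equipped with the connection $\pi_T^*\nabla$, where $\pi_T:T\times T^\vee\to T$ is the projection. *)

theory Defs
  imports "HOL-Analysis.Analysis" "HOL-Library.Z2"
begin

section \<open>Lattices, tori and constant two-forms\<close>

definition full_lattice :: "'a::real_vector set \<Rightarrow> bool" where
  "full_lattice \<Lambda> \<longleftrightarrow>
     (\<exists>B. finite B \<and> independent B \<and> span B = UNIV \<and>
          \<Lambda> = {\<Sum>b\<in>B. of_int (c b) *\<^sub>R b | c. True})"

text \<open>Points of the torus \<open>V/\<Lambda>\<close> are the cosets of \<open>\<Lambda>\<close>;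
  \<open>shift v p\<close> is the translate of the point \<open>p\<close> by \<open>v\<close>.\<close>

definition torus_proj :: "'a::real_vector set \<Rightarrow> 'a \<Rightarrow> 'a set" where
  "torus_proj \<Lambda> v = {v + l | l. l \<in> \<Lambda>}"

definition torus :: "'a::real_vector set \<Rightarrow> 'a set set" where
  "torus \<Lambda> = range (torus_proj \<Lambda>)"

definition shift :: "'a::real_vector \<Rightarrow> 'a set \<Rightarrow> 'a set" where
  "shift v p = (\<lambda>y. y + v) ` p"

text \<open>Quotient topology.\<close>

definition torus_open :: "'a::real_normed_vector set \<Rightarrow> 'a set set \<Rightarrow> bool" where
  "torus_open \<Lambda> Y \<longleftrightarrow> Y \<subseteq> torus \<Lambda> \<and> open {v. torus_proj \<Lambda> v \<in> Y}"

definition dual_lattice :: "'a::real_normed_vector set \<Rightarrow> ('a \<Rightarrow>\<^sub>L real) set" where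
  "dual_lattice \<Lambda> = {f. \<forall>\<gamma>\<in>\<Lambda>. blinfun_apply f \<gamma> \<in> \<int>}"

text \<open>The value does not depend on the representative when \<open>\<gamma> \<in> \<Lambda>\<close>.\<close>

definition dual_pairing :: "('a::real_normed_vector \<Rightarrow>\<^sub>L real) set \<Rightarrow> 'a \<Rightarrow> complex" where
  "dual_pairing xh \<gamma> =
     exp (2 * of_real pi * \<i> * of_real (blinfun_apply (SOME f. f \<in> xh) \<gamma>))"

definition two_form_on :: "'a::real_vector set \<Rightarrow> ('a \<Rightarrow> 'a \<Rightarrow> real) \<Rightarrow> bool" where
  "two_form_on W \<beta> \<longleftrightarrow>
     (\<forall>u\<in>W. \<forall>v\<in>W. \<forall>w\<in>W. \<forall>a b. \<beta> (a *\<^sub>R u + b *\<^sub>R v) w = a * \<beta> u w + b * \<beta> v w) \<and>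
     (\<forall>u\<in>W. \<forall>v\<in>W. \<beta> u v = - \<beta> v u)"

definition symplectic_form :: "('a::euclidean_space \<Rightarrow> 'a \<Rightarrow> real) \<Rightarrow> bool" where
  "symplectic_form \<omega> \<longleftrightarrow> two_form_on UNIV \<omega> \<and> (\<forall>u. (\<forall>v. \<omega> u v = 0) \<longrightarrow> u = 0)"

text \<open>A two-form as a map \<open>u \<mapsto> \<beta>(u, _)\<close> into the dual space, and its inverse.\<close>

definition flat :: "('a::euclidean_space \<Rightarrow> 'a \<Rightarrow> real) \<Rightarrow> 'a \<Rightarrow> ('a \<Rightarrow>\<^sub>L real)" where
  "flat \<beta> u = Blinfun (\<beta> u)"

definition sharp :: "('a::euclidean_space \<Rightarrow> 'a \<Rightarrow> real) \<Rightarrow> ('a \<Rightarrow>\<^sub>L real) \<Rightarrow> 'a" where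
  "sharp \<beta> = inv (flat \<beta>)"


section \<open>Smooth functions\<close>

definition dir_deriv :: "'a::real_normed_vector \<Rightarrow> ('a \<Rightarrow> 'b::real_normed_vector) \<Rightarrow> 'a \<Rightarrow> 'b" where
  "dir_deriv v f x = vector_derivative (\<lambda>t. f (x + t *\<^sub>R v)) (at 0)"

text \<open>\<open>C\<^sup>k\<close> functions on \<open>S\<close>, differentiated in the directions of the linear subspace \<open>W\<close> only.
  Used for \<open>W = UNIV\<close> and \<open>S\<close> open, and for \<open>S\<close> relatively open in a locally finite union of
  translates of \<open>W\<close>; in finite dimension, continuity of all iterated directional derivatives
  is the usual notion.\<close>

primrec Ck_on :: "'a::real_normed_vector set \<Rightarrow> 'a set \<Rightarrow> nat \<Rightarrow> ('a \<Rightarrow> 'b::real_normed_vector) \<Rightarrow> bool" where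
  "Ck_on W S 0 f \<longleftrightarrow> continuous_on S f"
| "Ck_on W S (Suc k) f \<longleftrightarrow> continuous_on S f \<and>
     (\<forall>v\<in>W. (\<forall>x\<in>S. (\<lambda>t::real. f (x + t *\<^sub>R v)) differentiable (at 0)) \<and>
             Ck_on W S k (dir_deriv v f))"

definition smooth_along :: "'a::real_normed_vector set \<Rightarrow> 'a set \<Rightarrow> ('a \<Rightarrow> 'b::real_normed_vector) \<Rightarrow> bool" where
  "smooth_along W S f \<longleftrightarrow> (\<forall>k. Ck_on W S k f)"


section \<open>Affine subtori and Hermitian line bundles with unitary connection\<close>

text \<open>\<open>W\<close> is the tangent space of the subtorus \<open>C\<close>, and
  \<open>\<Lambda> \<inter> W = H\<^sub>1(C; \<int>)\<close> is a full lattice in it.\<close>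

definition affine_subtorus :: "'a::euclidean_space set \<Rightarrow> 'a set set \<Rightarrow> 'a set \<Rightarrow> bool" where
  "affine_subtorus \<Lambda> C W \<longleftrightarrow> subspace W \<and> span (\<Lambda> \<inter> W) = W \<and>
     (\<exists>x0. C = {torus_proj \<Lambda> (x0 + w) | w. w \<in> W})"

text \<open>A Hermitian line bundle with unitary connection in local unitary frames indexed by \<open>'i\<close>.
  A section has components \<open>s\<^sub>i\<close> on \<open>patch i\<close> with \<open>s\<^sub>i = g\<^sub>i\<^sub>j s\<^sub>j\<close> (\<open>g = trans\<close>),
  and \<open>\<nabla> s\<close> has components \<open>ds\<^sub>i + A\<^sub>i s\<^sub>i\<close> (\<open>A = potential\<close>).\<close>

record ('i, 'a) line_connection =
  patch :: "'i \<Rightarrow> 'a set set"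
  trans :: "'i \<Rightarrow> 'i \<Rightarrow> 'a set \<Rightarrow> complex"
  potential :: "'i \<Rightarrow> 'a set \<Rightarrow> 'a \<Rightarrow> complex"

definition smooth_on_subtorus ::
  "'a::euclidean_space set \<Rightarrow> 'a set \<Rightarrow> 'a set set \<Rightarrow> ('a set \<Rightarrow> complex) \<Rightarrow> bool" where
  "smooth_on_subtorus \<Lambda> W U f \<longleftrightarrow>
     smooth_along W {v. torus_proj \<Lambda> v \<in> U} (\<lambda>v. f (torus_proj \<Lambda> v))"

definition torus_deriv :: "'a::real_vector \<Rightarrow> ('a set \<Rightarrow> complex) \<Rightarrow> 'a set \<Rightarrow> complex" where
  "torus_deriv v f p = vector_derivative (\<lambda>t. f (shift (t *\<^sub>R v) p)) (at 0)"

definition unitary_line_connection ::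
  "'a::euclidean_space set \<Rightarrow> 'a set set \<Rightarrow> 'a set \<Rightarrow> ('i, 'a) line_connection \<Rightarrow> bool" where
  "unitary_line_connection \<Lambda> C W N \<longleftrightarrow>
     (\<forall>i. \<exists>Y. torus_open \<Lambda> Y \<and> patch N i = C \<inter> Y) \<and>
     (\<Union>i. patch N i) = C \<and>
     (\<forall>i j. smooth_on_subtorus \<Lambda> W (patch N i \<inter> patch N j) (trans N i j)) \<and>
     (\<forall>i j. \<forall>p \<in> patch N i \<inter> patch N j. norm (trans N i j p) = 1) \<and>
     (\<forall>i j k. \<forall>p \<in> patch N i \<inter> patch N j \<inter> patch N k.
        trans N i j p * trans N j k p = trans N i k p) \<and>
     (\<forall>i. \<forall>v\<in>W. smooth_on_subtorus \<Lambda> W (patch N i) (\<lambda>p. potential N i p v)) \<and>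
     (\<forall>i. \<forall>p\<in>patch N i. \<forall>u\<in>W. \<forall>v\<in>W. \<forall>a b.
        potential N i p (a *\<^sub>R u + b *\<^sub>R v) = a *\<^sub>R potential N i p u + b *\<^sub>R potential N i p v) \<and>
     (\<forall>i. \<forall>p\<in>patch N i. \<forall>v\<in>W. Re (potential N i p v) = 0) \<and>
     (\<forall>i j. \<forall>p \<in> patch N i \<inter> patch N j. \<forall>v\<in>W.
        torus_deriv v (trans N i j) p = trans N i j p * (potential N j p v - potential N i p v))"

text \<open>\<open>(dA)(u, v)\<close> for constant vector fields \<open>u\<close>, \<open>v\<close>, computed in the frame \<open>i\<close>.\<close>

definition curvature :: "('i, 'a::real_vector) line_connection \<Rightarrow> 'i \<Rightarrow> 'a set \<Rightarrow> 'a \<Rightarrow> 'a \<Rightarrow> complex" where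
  "curvature N i p u v =
     torus_deriv u (\<lambda>p. potential N i p v) p - torus_deriv v (\<lambda>p. potential N i p u) p"

text \<open>A parallel section along a curve \<open>c\<close> in \<open>C\<close> with velocity \<open>c'\<close>, both on \<open>[0,1]\<close>:
  \<open>s i t\<close> is its component in frame \<open>i\<close>, relevant when \<open>c t \<in> patch N i\<close>.\<close>

definition parallel_section ::
  "('i, 'a::real_vector) line_connection \<Rightarrow> (real \<Rightarrow> 'a set) \<Rightarrow> (real \<Rightarrow> 'a) \<Rightarrow> ('i \<Rightarrow> real \<Rightarrow> complex) \<Rightarrow> bool" where
  "parallel_section N c c' s \<longleftrightarrow>
     (\<forall>t\<in>{0..1}. \<forall>i j. c t \<in> patch N i \<inter> patch N j \<longrightarrow> s i t = trans N i j (c t) * s j t) \<and>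
     (\<forall>t\<in>{0..1}. \<forall>i. c t \<in> patch N i \<longrightarrow>
        (s i has_vector_derivative (- potential N i (c t) (c' t) * s i t)) (at t within {0..1}))"

definition holonomy ::
  "('i, 'a::real_vector) line_connection \<Rightarrow> (real \<Rightarrow> 'a set) \<Rightarrow> (real \<Rightarrow> 'a) \<Rightarrow> complex" where
  "holonomy N c c' =
     (THE z. \<forall>s. parallel_section N c c' s \<longrightarrow> (\<forall>i. c 0 \<in> patch N i \<longrightarrow> s i 1 = z * s i 0))"

definition linear_loop :: "'a::real_vector set \<Rightarrow> 'a \<Rightarrow> real \<Rightarrow> 'a set" where
  "linear_loop p \<gamma> t = shift (t *\<^sub>R \<gamma>) p"

definition loop_holonomy :: "('i, 'a::real_vector) line_connection \<Rightarrow> 'a set \<Rightarrow> 'a \<Rightarrow> complex" where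
  "loop_holonomy N p \<gamma> = holonomy N (linear_loop p \<gamma>) (\<lambda>_. \<gamma>)"


section \<open>Linear coisotropic branes and their lifts\<close>

definition sympl_orth :: "('a \<Rightarrow> 'a \<Rightarrow> real) \<Rightarrow> 'a set \<Rightarrow> 'a set" where
  "sympl_orth \<omega> W = {u. \<forall>v\<in>W. \<omega> u v = 0}"

definition iso_dirs :: "('a \<Rightarrow> 'a \<Rightarrow> real) \<Rightarrow> 'a set \<Rightarrow> 'a set" where
  "iso_dirs \<omega> W = {u\<in>W. \<forall>v\<in>W. \<omega> u v = 0}"

text \<open>The quotient \<open>W / iso_dirs \<omega> W\<close>, as a set of cosets.\<close>

definition reduction :: "('a::real_vector \<Rightarrow> 'a \<Rightarrow> real) \<Rightarrow> 'a set \<Rightarrow> 'a set set" where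
  "reduction \<omega> W = (\<lambda>u. {u + k | k. k \<in> iso_dirs \<omega> W}) ` W"

text \<open>\<open>\<omega>\<inverse>F\<close> on the reduction: the class of those \<open>v\<close> with
  \<open>\<omega>(v, _) = F(u, _)\<close> on \<open>W\<close>, where \<open>u\<close> represents \<open>X\<close>.\<close>

definition omega_inv_F ::
  "('a \<Rightarrow> 'a \<Rightarrow> real) \<Rightarrow> ('a \<Rightarrow> 'a \<Rightarrow> real) \<Rightarrow> 'a set \<Rightarrow> 'a set \<Rightarrow> 'a set" where
  "omega_inv_F \<omega> F W X = {v\<in>W. \<forall>u\<in>X. \<forall>z\<in>W. \<omega> v z = F u z}"

definition linear_coisotropic_brane ::
  "'a::euclidean_space set \<Rightarrow> ('a \<Rightarrow> 'a \<Rightarrow> real) \<Rightarrow> 'a set set \<Rightarrow> 'a set \<Rightarrow>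
   ('i, 'a) line_connection \<Rightarrow> ('a \<Rightarrow> 'a \<Rightarrow> real) \<Rightarrow> bool" where
  "linear_coisotropic_brane \<Lambda> \<omega> C W N F \<longleftrightarrow>
     affine_subtorus \<Lambda> C W \<and>
     sympl_orth \<omega> W \<subseteq> W \<and>
     unitary_line_connection \<Lambda> C W N \<and>
     two_form_on W F \<and>
     (\<forall>i. \<forall>p\<in>patch N i. \<forall>u\<in>W. \<forall>v\<in>W.
        curvature N i p u v = - 2 * of_real pi * \<i> * of_real (F u v)) \<and>
     (\<forall>u\<in>iso_dirs \<omega> W. \<forall>v\<in>W. F u v = 0) \<and>
     (\<forall>X\<in>reduction \<omega> W. omega_inv_F \<omega> F W X \<in> reduction \<omega> W \<and>
        omega_inv_F \<omega> F W (omega_inv_F \<omega> F W X) = uminus ` X)"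

text \<open>The first Chern form \<open>\<i>/(2\<pi>) \<cdot> (-2\<pi>\<i>F) = F\<close> is constant, so its integral over the
  2-torus spanned by \<open>\<gamma>\<close>, \<open>\<gamma>'\<close> is \<open>F \<gamma> \<gamma>'\<close>; this is an integer because \<open>F\<close> is a curvature,
  and the floor only changes its type.\<close>

definition chern_number :: "('a \<Rightarrow> 'a \<Rightarrow> real) \<Rightarrow> 'a \<Rightarrow> 'a \<Rightarrow> int" where
  "chern_number F \<gamma> \<gamma>' = \<lfloor>F \<gamma> \<gamma>'\<rfloor>"

definition lift_sign_function ::
  "'a::real_vector set \<Rightarrow> 'a set \<Rightarrow> ('a \<Rightarrow> 'a \<Rightarrow> real) \<Rightarrow> ('a \<Rightarrow> bit) \<Rightarrow> bool" where
  "lift_sign_function \<Lambda> W F \<xi> \<longleftrightarrow>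
     (\<forall>\<gamma>\<in>\<Lambda> \<inter> W. \<forall>\<gamma>'\<in>\<Lambda> \<inter> W. \<xi> (\<gamma> + \<gamma>') - \<xi> \<gamma> - \<xi> \<gamma>' = of_int (chern_number F \<gamma> \<gamma>'))"

definition minus_one_pow :: "bit \<Rightarrow> complex" where
  "minus_one_pow b = (if b = 0 then 1 else - 1)"

definition brane_lift ::
  "'a::euclidean_space set \<Rightarrow> 'a set set \<Rightarrow> 'a set \<Rightarrow> ('i, 'a) line_connection \<Rightarrow> ('a \<Rightarrow> bit) \<Rightarrow>
   ('a set \<times> ('a \<Rightarrow>\<^sub>L real) set) set" where
  "brane_lift \<Lambda> C W N \<xi> =
     {(p, xh) \<in> torus \<Lambda> \<times> torus (dual_lattice \<Lambda>). p \<in> C \<and>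
        (\<forall>\<gamma>\<in>\<Lambda> \<inter> W. dual_pairing xh \<gamma> = minus_one_pow (\<xi> \<gamma>) * loop_holonomy N p \<gamma>)}"


section \<open>The doubling torus\<close>

definition doubling_proj ::
  "'a::euclidean_space set \<Rightarrow> 'a \<times> ('a \<Rightarrow>\<^sub>L real) \<Rightarrow> 'a set \<times> ('a \<Rightarrow>\<^sub>L real) set" where
  "doubling_proj \<Lambda> = (\<lambda>(v, f). (torus_proj \<Lambda> v, torus_proj (dual_lattice \<Lambda>) f))"

text \<open>The form \<open>\<onehalf>\<omega> \<oplus> -\<onehalf>\<omega>\<inverse>\<close>, with the convention \<open>-\<omega>\<inverse>(\<alpha>, \<beta>) = \<alpha>(\<omega>\<inverse>\<beta>)\<close>.\<close>

definition doubling_form ::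
  "('a::euclidean_space \<Rightarrow> 'a \<Rightarrow> real) \<Rightarrow> 'a \<times> ('a \<Rightarrow>\<^sub>L real) \<Rightarrow> 'a \<times> ('a \<Rightarrow>\<^sub>L real) \<Rightarrow> real" where
  "doubling_form \<omega> = (\<lambda>(u, \<alpha>) (v, \<beta>). 1/2 * \<omega> u v + 1/2 * blinfun_apply \<alpha> (sharp \<omega> \<beta>))"

definition doubling_J ::
  "('a::euclidean_space \<Rightarrow> 'a \<Rightarrow> real) \<Rightarrow> 'a \<times> ('a \<Rightarrow>\<^sub>L real) \<Rightarrow> 'a \<times> ('a \<Rightarrow>\<^sub>L real)" where
  "doubling_J \<omega> = (\<lambda>(u, f). (sharp \<omega> f, - flat \<omega> u))"


section \<open>Submanifolds of a quotient\<close>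

text \<open>\<open>q : E \<rightarrow> X\<close> is a covering of a manifold by a vector space, whose local inverses are
  the charts of \<open>X\<close> and which identifies every tangent space of \<open>X\<close> with \<open>E\<close>. A slice chart
  straightens \<open>S\<close> inside the chart domain \<open>q ` U\<close> to the linear subspace \<open>L\<close>.\<close>

definition slice_chart ::
  "('e::real_normed_vector \<Rightarrow> 'x) \<Rightarrow> 'x set \<Rightarrow> 'e set \<Rightarrow> ('e \<Rightarrow> 'e) \<Rightarrow> 'e set \<Rightarrow> bool" where
  "slice_chart q S U \<phi> L \<longleftrightarrow>
     open U \<and> inj_on q U \<and> inj_on \<phi> U \<and> open (\<phi> ` U) \<and>
     smooth_along UNIV U \<phi> \<and> smooth_along UNIV (\<phi> ` U) (the_inv_into U \<phi>) \<and>
     subspace L \<and> \<phi> ` {u\<in>U. q u \<in> S} = \<phi> ` U \<inter> L"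

definition submanifold :: "('e::real_normed_vector \<Rightarrow> 'x) \<Rightarrow> nat \<Rightarrow> 'x set \<Rightarrow> bool" where
  "submanifold q k S \<longleftrightarrow> S \<noteq> {} \<and> S \<subseteq> range q \<and>
     (\<forall>p\<in>S. \<exists>e U \<phi> L. q e = p \<and> e \<in> U \<and> slice_chart q S U \<phi> L \<and> dim L = k)"

definition tangent_space :: "('e::real_normed_vector \<Rightarrow> 'x) \<Rightarrow> 'x set \<Rightarrow> 'e \<Rightarrow> 'e set" where
  "tangent_space q S e =
     {v. \<exists>c. c 0 = e \<and> (c has_vector_derivative v) (at (0::real)) \<and> (\<forall>\<^sub>F t in nhds 0. q (c t) \<in> S)}"

definition lagrangian_submanifold ::
  "('e::real_normed_vector \<Rightarrow> 'x) \<Rightarrow> ('e \<Rightarrow> 'e \<Rightarrow> real) \<Rightarrow> 'x set \<Rightarrow> bool" where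
  "lagrangian_submanifold q \<sigma> S \<longleftrightarrow> (\<exists>k. submanifold q k S) \<and>
     (\<forall>e. q e \<in> S \<longrightarrow> sympl_orth \<sigma> (tangent_space q S e) = tangent_space q S e)"

definition complex_submanifold ::
  "('e::real_normed_vector \<Rightarrow> 'x) \<Rightarrow> ('e \<Rightarrow> 'e) \<Rightarrow> 'x set \<Rightarrow> bool" where
  "complex_submanifold q J S \<longleftrightarrow> S \<noteq> {} \<and> S \<subseteq> range q \<and>
     (\<exists>k. \<forall>p\<in>S. \<exists>e U \<phi> L. q e = p \<and> e \<in> U \<and> slice_chart q S U \<phi> L \<and> dim L = k \<and>
        (\<forall>x\<in>U. \<exists>D. (\<phi> has_derivative D) (at x) \<and> (\<forall>v. D (J v) = J (D v))) \<and> J ` L \<subseteq> L)"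

end

theory Submission
  imports Defs
begin

text \<open>
  Write \<open>H\<close> for the lattice \<open>\<Lambda> \<inter> W\<close>, so that \<open>C\<close> is a torus \<open>W/H\<close> and its cover is \<open>x0 + W\<close>. Everything
  rests on two properties of the holonomy along linear loops.

  Moving the base point by \<open>w\<close> multiplies the holonomy along \<open>\<gamma>\<close> by \<open>exp (2\<pi>\<i> F(w, \<gamma>))\<close>, by Stokes'
  theorem for the parallelogram on \<open>w\<close> and \<open>\<gamma>\<close> (\<open>loop_holonomy_translate\<close>). Hence the
  condition on \<open>(x, f)\<close> that defines the lift is preserved by a displacement \<open>(u, g)\<close> with \<open>u \<in> W\<close> if
  and only if \<open>g \<gamma> - F(u, \<gamma>)\<close> is an integer for all \<open>\<gamma> \<in> H\<close>. For small displacements the integers are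
  zero, and since \<open>H\<close> spans \<open>W\<close> the lift is, near each of its points, a translate of one fixed linear
  space: the pairs \<open>(u, g)\<close> with \<open>u \<in> W\<close> and \<open>g = F(u, _)\<close> on \<open>W\<close> (\<open>lift_tangent\<close>). Translations
  therefore serve as charts, and their derivative, the identity, commutes with \<open>J\<close>.

  Along \<open>\<gamma> + \<gamma>'\<close> the holonomy is the product of those along \<open>\<gamma>\<close> and \<open>\<gamma>'\<close> up to \<open>exp (\<pi>\<i> F(\<gamma>, \<gamma>'))\<close>
  (\<open>loop_holonomy_add\<close>), and \<open>F\<close> is integral on \<open>H\<close>. So the signs given by \<open>\<xi>\<close> produce a character of \<open>H\<close>,
  and every character of a subgroup of a lattice is the exponential of a linear functional
  (\<open>lattice_character_exp\<close>); the lift is not empty.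

  To get both properties without parallel transport along curved or broken paths, subtract from
  the connection the linear primitive \<open>theta\<close> of its constant curvature. What remains is flat, and
  over every bounded convex piece of \<open>x0 + W\<close> it has a parallel section \<open>\<sigma>\<close>: locally by the
  Poincare lemma, globally by gluing along hyperplanes (\<open>flat_section_exists\<close>). The holonomy is then
  explicit, \<open>\<sigma>(x + \<gamma>)/\<sigma>(x) exp (\<pi>\<i> F(x - x0, \<gamma>))\<close>, and the two properties are computations.

  It remains to see that \<open>lift_tangent\<close> is \<open>J\<close>-invariant and Lagrangian. Replace \<open>g\<close> by \<open>a\<close> with
  \<open>\<omega>(a, _) = g\<close>. Since \<open>F\<close> vanishes on the symplectic complement of \<open>W\<close>, which lies in \<open>W\<close>, also
  \<open>a \<in> W\<close>, and the complex structure \<open>\<omega>\<inverse>F\<close> takes \<open>u\<close> to \<open>a\<close> and \<open>a\<close> to \<open>-u\<close>, while \<open>J\<close> takes \<open>(u, a)\<close> to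
  \<open>(a, -u)\<close> and the form of the doubling torus is half of \<open>\<omega>(u, v) + \<omega>(a, b)\<close>.
\<close>

section \<open>Lattices and tori\<close>

definition add_subgroup :: "'a::ab_group_add set \<Rightarrow> bool" where
  "add_subgroup H \<longleftrightarrow> 0 \<in> H \<and> (\<forall>a\<in>H. \<forall>b\<in>H. a - b \<in> H)"

lemma add_subgroupD:
  assumes "add_subgroup H"
  shows "0 \<in> H" "\<And>a b. a \<in> H \<Longrightarrow> b \<in> H \<Longrightarrow> a - b \<in> H"
    "\<And>a. a \<in> H \<Longrightarrow> - a \<in> H" "\<And>a b. a \<in> H \<Longrightarrow> b \<in> H \<Longrightarrow> a + b \<in> H"
proof -
  show 0: "0 \<in> H" and d: "\<And>a b. a \<in> H \<Longrightarrow> b \<in> H \<Longrightarrow> a - b \<in> H"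
    using assms by (auto simp: add_subgroup_def)
  show m: "- a \<in> H" if "a \<in> H" for a
    using d[OF 0 that] by simp
  show "a + b \<in> H" if "a \<in> H" "b \<in> H" for a b
    using d[OF that(1) m[OF that(2)]] by simp
qed

lemma add_subgroup_scale_int:
  fixes H :: "'a::real_vector set"
  assumes "add_subgroup H" "a \<in> H"
  shows "of_int k *\<^sub>R a \<in> H"
proof -
  have n: "of_nat m *\<^sub>R a \<in> H" for m
    by (induction m) (auto simp: scaleR_add_left assms add_subgroupD[OF assms(1)])
  show ?thesis
  proof (cases "k \<ge> 0")
    case True
    then show ?thesis using n[of "nat k"] by simp
  next
    case False
    then show ?thesis using add_subgroupD(3)[OF assms(1) n[of "nat (- k)"]] by simp
  qed
qed

lemma add_subgroup_int_principal:
  fixes D :: "int set"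
  assumes "add_subgroup D"
  obtains d where "d \<in> D" "\<And>k. k \<in> D \<Longrightarrow> d dvd k"
proof (cases "\<exists>k\<in>D. k \<noteq> 0")
  case False
  then show ?thesis using that[of 0] add_subgroupD(1)[OF assms] by auto
next
  case True
  then obtain k where k: "k \<in> D" "k \<noteq> 0" by auto
  then have ex: "\<exists>n. n > 0 \<and> int n \<in> D"
    using add_subgroupD(3)[OF assms k(1)]
    by (cases "k > 0") (auto intro: exI[of _ "nat k"] exI[of _ "nat (- k)"])
  define n where "n = (LEAST n. n > 0 \<and> int n \<in> D)"
  have n: "n > 0" "int n \<in> D"
    using LeastI_ex[OF ex] by (auto simp: n_def)
  have mult: "int n * m \<in> D" for m
  proof -
    have p: "int n * int j \<in> D" for j
      by (induction j) (auto simp: algebra_simps n add_subgroupD[OF assms])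
    show ?thesis
    proof (cases "m \<ge> 0")
      case True
      then show ?thesis using p[of "nat m"] by simp
    next
      case False
      then show ?thesis using add_subgroupD(3)[OF assms p[of "nat (- m)"]] by simp
    qed
  qed
  have "int n dvd k" if "k \<in> D" for k
  proof (rule ccontr)
    assume nd: "\<not> int n dvd k"
    have "k - int n * (k div int n) \<in> D"
      using add_subgroupD(2)[OF assms that mult] .
    then have r: "k mod int n \<in> D"
      by (simp add: minus_mult_div_eq_mod)
    have "k mod int n > 0"
      using nd n(1) by (metis dvd_eq_mod_eq_0 of_nat_0_less_iff pos_mod_sign order_le_less)
    moreover have "k mod int n < int n"
      using n(1) by simp
    ultimately have "nat (k mod int n) > 0 \<and> int (nat (k mod int n)) \<in> D"
      "nat (k mod int n) < n"
      using r by auto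
    then show False
      using not_less_Least[of "nat (k mod int n)" "\<lambda>n. n > 0 \<and> int n \<in> D"] by (auto simp: n_def)
  qed
  then show ?thesis using that n(2) by blast
qed

lemma add_subgroup_full_lattice:
  assumes "full_lattice \<Lambda>"
  shows "add_subgroup \<Lambda>"
proof -
  obtain B where B: "\<Lambda> = {\<Sum>b\<in>B. of_int (c b) *\<^sub>R b | c. True}"
    using assms by (auto simp: full_lattice_def)
  have "0 \<in> \<Lambda>"
    unfolding B by (auto intro!: exI[of _ "\<lambda>_. 0"])
  moreover have "a - b \<in> \<Lambda>" if ab: "a \<in> \<Lambda>" "b \<in> \<Lambda>" for a b
  proof -
    obtain c d where "a = (\<Sum>b\<in>B. of_int (c b) *\<^sub>R b)" "b = (\<Sum>b\<in>B. of_int (d b) *\<^sub>R b)"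
      using ab by (auto simp: B)
    then have "a - b = (\<Sum>x\<in>B. of_int (c x - d x) *\<^sub>R x)"
      by (simp add: sum_subtractf scaleR_diff_left)
    then show ?thesis unfolding B by (intro CollectI exI[of _ "\<lambda>x. c x - d x"]) simp
  qed
  ultimately show ?thesis by (simp add: add_subgroup_def)
qed

lemma add_subgroup_dual_lattice: "add_subgroup (dual_lattice \<Lambda>)"
  by (auto simp: add_subgroup_def dual_lattice_def blinfun.diff_left)

lemma shift_torus_proj: "shift w (torus_proj \<Lambda> v) = torus_proj \<Lambda> (v + w)"
  unfolding shift_def torus_proj_def by (force simp: algebra_simps image_iff)

lemma torus_proj_self: "add_subgroup \<Lambda> \<Longrightarrow> v \<in> torus_proj \<Lambda> v"
  unfolding torus_proj_def using add_subgroupD(1) by force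

lemma torus_proj_eq_iff:
  assumes "add_subgroup \<Lambda>"
  shows "torus_proj \<Lambda> v = torus_proj \<Lambda> v' \<longleftrightarrow> v - v' \<in> \<Lambda>"
proof
  assume "torus_proj \<Lambda> v = torus_proj \<Lambda> v'"
  then have "v \<in> torus_proj \<Lambda> v'"
    using torus_proj_self[OF assms] by blast
  then show "v - v' \<in> \<Lambda>" by (auto simp: torus_proj_def)
next
  assume d: "v - v' \<in> \<Lambda>"
  have "\<exists>l'\<in>\<Lambda>. v + l = v' + l'" if "l \<in> \<Lambda>" for l
    using add_subgroupD(4)[OF assms that d] by (intro bexI[of _ "l + (v - v')"]) auto
  moreover have "\<exists>l'\<in>\<Lambda>. v' + l = v + l'" if "l \<in> \<Lambda>" for l
    using add_subgroupD(2)[OF assms that d] by (intro bexI[of _ "l - (v - v')"]) auto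
  ultimately show "torus_proj \<Lambda> v = torus_proj \<Lambda> v'"
    unfolding torus_proj_def by blast
qed

lemma dual_pairing_torus_proj:
  assumes "\<gamma> \<in> \<Lambda>"
  shows "dual_pairing (torus_proj (dual_lattice \<Lambda>) f) \<gamma> = exp (2 * of_real pi * \<i> * of_real (blinfun_apply f \<gamma>))"
proof -
  define g where "g = (SOME g. g \<in> torus_proj (dual_lattice \<Lambda>) f)"
  have "g \<in> torus_proj (dual_lattice \<Lambda>) f"
    unfolding g_def by (rule someI) (rule torus_proj_self[OF add_subgroup_dual_lattice])
  then obtain h where h: "g = f + h" "h \<in> dual_lattice \<Lambda>"
    by (auto simp: torus_proj_def)
  then obtain k :: int where k: "blinfun_apply h \<gamma> = of_int k"
    using assms by (auto simp: dual_lattice_def Ints_def)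
  have "exp (2 * of_real pi * \<i> * of_real (blinfun_apply g \<gamma>)) = exp (2 * of_real pi * \<i> * of_real (blinfun_apply f \<gamma>))"
    unfolding exp_eq by (intro exI[of _ k]) (simp add: h(1) blinfun.add_left k algebra_simps)
  then show ?thesis
    by (simp add: dual_pairing_def g_def)
qed

text \<open>The coordinates with respect to a lattice basis are bounded linear functionals, so a bounded
  set contains only finitely many vectors with integral coordinates.\<close>

lemma finite_full_lattice_cball:
  fixes \<Lambda> :: "'a::euclidean_space set"
  assumes "full_lattice \<Lambda>"
  shows "finite (\<Lambda> \<inter> cball 0 R)"
proof -
  obtain B where B: "finite B" "independent B" "span B = UNIV"
    "\<Lambda> = {\<Sum>b\<in>B. of_int (c b) *\<^sub>R b | c. True}"
    using assms by (auto simp: full_lattice_def)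
  have lin: "linear (\<lambda>v. representation B v b)" for b
    by (rule linearI) (auto simp: B representation_add representation_scale)
  have rep: "representation B (\<Sum>b\<in>B. of_int (c b) *\<^sub>R b) b = of_int (c b)" if "b \<in> B" for c :: "'a \<Rightarrow> int" and b
  proof -
    have "representation B (\<Sum>b\<in>B. of_int (c b) *\<^sub>R b) b = (\<Sum>x\<in>B. of_int (c x) * representation B x b)"
      by (simp add: linear_sum[OF lin] linear_scale[OF lin])
    also have "\<dots> = (\<Sum>x\<in>B. if x = b then of_int (c x) else 0)"
      by (intro sum.cong) (auto simp: representation_basis[OF B(2)])
    finally show ?thesis using that B(1) by simp
  qed
  have "\<forall>b. \<exists>M. \<forall>v. norm (representation B v b) \<le> norm v * M"
    using lin linear_conv_bounded_linear bounded_linear.bounded by blast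
  then obtain M where M: "\<And>b v. norm (representation B v b) \<le> norm v * M b"
    by metis
  define K where "K = \<lceil>Max (insert 0 ((\<lambda>b. \<bar>R\<bar> * \<bar>M b\<bar>) ` B))\<rceil>"
  have "\<Lambda> \<inter> cball 0 R \<subseteq> (\<lambda>c. \<Sum>b\<in>B. of_int (c b) *\<^sub>R b) ` (PiE B (\<lambda>_. {-K..K}))"
  proof
    fix v assume v: "v \<in> \<Lambda> \<inter> cball 0 R"
    then obtain c where c: "v = (\<Sum>b\<in>B. of_int (c b) *\<^sub>R b)" by (auto simp: B(4))
    have "c b \<in> {-K..K}" if b: "b \<in> B" for b
    proof -
      have "\<bar>real_of_int (c b)\<bar> \<le> norm v * M b"
        using M[of v b] rep[OF b, of c] by (simp add: c)
      also have "\<dots> \<le> \<bar>R\<bar> * \<bar>M b\<bar>"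
      proof -
        have "norm v * M b \<le> norm v * \<bar>M b\<bar>" by (intro mult_left_mono) auto
        also have "\<dots> \<le> \<bar>R\<bar> * \<bar>M b\<bar>" using v by (intro mult_right_mono) auto
        finally show ?thesis .
      qed
      also have "\<dots> \<le> Max (insert 0 ((\<lambda>b. \<bar>R\<bar> * \<bar>M b\<bar>) ` B))"
        using B(1) b by (intro Max_ge) auto
      also have "\<dots> \<le> of_int K" by (simp add: K_def)
      finally show ?thesis by auto
    qed
    then have "restrict c B \<in> PiE B (\<lambda>_. {-K..K})" by auto
    moreover have "v = (\<Sum>b\<in>B. of_int (restrict c B b) *\<^sub>R b)"
      unfolding c by (intro sum.cong) auto
    ultimately show "v \<in> (\<lambda>c. \<Sum>b\<in>B. of_int (c b) *\<^sub>R b) ` (PiE B (\<lambda>_. {-K..K}))"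
      by blast
  qed
  moreover have "finite (PiE B (\<lambda>_. {-K..K}))" using B(1) by (intro finite_PiE) auto
  ultimately show ?thesis using finite_surj by blast
qed

lemma full_lattice_discrete:
  fixes \<Lambda> :: "'a::euclidean_space set"
  assumes "full_lattice \<Lambda>"
  obtains r where "r > 0" "\<And>l. l \<in> \<Lambda> \<Longrightarrow> norm l < r \<Longrightarrow> l = 0"
proof -
  obtain d where d: "d > 0" "\<forall>x\<in>\<Lambda> \<inter> cball 0 1. x \<noteq> 0 \<longrightarrow> d \<le> dist 0 x"
    using finite_set_avoid[OF finite_full_lattice_cball[OF assms]] by blast
  show ?thesis
    using d by (intro that[of "min d 1"]) force+
qed

lemma dual_lattice_discrete:
  fixes \<Lambda> :: "'a::euclidean_space set"
  assumes "full_lattice \<Lambda>"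
  obtains r where "r > 0" "\<And>f. f \<in> dual_lattice \<Lambda> \<Longrightarrow> norm f < r \<Longrightarrow> f = 0"
proof -
  obtain B where B: "finite B" "independent B" "span B = UNIV"
    "\<Lambda> = {\<Sum>b\<in>B. of_int (c b) *\<^sub>R b | c. True}"
    using assms by (auto simp: full_lattice_def)
  have BL: "b \<in> \<Lambda>" if "b \<in> B" for b
  proof -
    have "(\<Sum>x\<in>B. of_int (if x = b then 1 else 0) *\<^sub>R x) = (\<Sum>x\<in>B. if x = b then x else 0)"
      by (intro sum.cong) auto
    then have "b = (\<Sum>x\<in>B. of_int (if x = b then 1 else 0) *\<^sub>R x)"
      using that B(1) by simp
    then show ?thesis unfolding B(4) by (intro CollectI exI[of _ "\<lambda>x. if x = b then 1 else 0"]) simp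
  qed
  define M where "M = 1 + (\<Sum>b\<in>B. norm b)"
  have M: "M > 0" "\<And>b. b \<in> B \<Longrightarrow> norm b \<le> M"
    using B(1) member_le_sum[of _ B norm] by (force simp: M_def intro: add_pos_nonneg sum_nonneg)+
  have "f = 0" if f: "f \<in> dual_lattice \<Lambda>" "norm f < 1 / M" for f
  proof -
    have "blinfun_apply f b = 0" if b: "b \<in> B" for b
    proof -
      have "\<bar>blinfun_apply f b\<bar> \<le> norm f * norm b"
        using norm_blinfun[of f b] by simp
      also have "\<dots> \<le> norm f * M" using M b by (intro mult_left_mono) auto
      also have "\<dots> < 1" using f(2) M by (simp add: field_simps)
      finally show ?thesis
        using f(1) BL[OF b] by (auto simp: dual_lattice_def Ints_def)
    qed
    then have "blinfun_apply f v = 0" for v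
      using linear_eq_0_on_span[of "blinfun_apply f" B v] B(3)
      by (auto simp: bounded_linear.linear blinfun.bounded_linear_right)
    then show ?thesis by (intro blinfun_eqI) simp
  qed
  then show ?thesis using M that[of "1 / M"] by auto
qed

text \<open>Modulo \<open>\<Lambda> \<inter> W\<close> every vector of \<open>W\<close> can be taken bounded, so only finitely many lattice vectors
  outside \<open>W\<close> compete for being close to \<open>W\<close>. Without a lattice in \<open>W\<close> the image of \<open>W\<close>
  in the torus could be dense and accumulate on itself.\<close>

lemma rational_subspace_isolated:
  fixes \<Lambda> W :: "'a::euclidean_space set"
  assumes L: "full_lattice \<Lambda>" and W: "subspace W" "span (\<Lambda> \<inter> W) = W"
  obtains r where "r > 0" "\<And>w l. w \<in> W \<Longrightarrow> l \<in> \<Lambda> \<Longrightarrow> norm (w + l) < r \<Longrightarrow> l \<in> W"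
proof -
  note sg = add_subgroup_full_lattice[OF L]
  obtain B where B: "B \<subseteq> \<Lambda> \<inter> W" "independent B" "span B = W"
    using maximal_independent_subset[of "\<Lambda> \<inter> W"] W
    by (metis span_subspace subset_trans inf_le2 span_mono span_span subset_antisym)
  then have fB: "finite B" using independent_bound by blast
  define M where "M = (\<Sum>b\<in>B. norm b)"
  define Q where "Q = \<Lambda> \<inter> cball 0 (M + 1) - W"
  have "finite Q" using finite_full_lattice_cball[OF L] by (simp add: Q_def)
  then obtain d where d: "d > 0" "\<forall>x\<in>Q. \<forall>y\<in>W. d \<le> dist x y"
    using separate_compact_closed[of Q W] finite_imp_compact closed_subspace[OF W(1)]
    by (auto simp: Q_def)
  have "l \<in> W" if w: "w \<in> W" and l: "l \<in> \<Lambda>" and n: "norm (w + l) < min d 1" for w l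
  proof (rule ccontr)
    assume lW: "l \<notin> W"
    obtain c where c: "w = (\<Sum>b\<in>B. c b *\<^sub>R b)"
      using w B(3) span_finite[OF fB] by auto
    define w' where "w' = (\<Sum>b\<in>B. frac (c b) *\<^sub>R b)"
    define m where "m = (\<Sum>b\<in>B. of_int \<lfloor>c b\<rfloor> *\<^sub>R b)"
    have wm: "w = w' + m"
      by (simp add: c w'_def m_def frac_def scaleR_diff_left sum_subtractf)
    have "m \<in> \<Lambda> \<and> m \<in> W"
    proof -
      have "(\<Sum>b\<in>A. of_int \<lfloor>c b\<rfloor> *\<^sub>R b) \<in> \<Lambda>" if "A \<subseteq> B" for A
        using finite_subset[OF that fB] that
      proof (induction A rule: finite_induct)
        case (insert x A)
        then show ?case
          using add_subgroup_scale_int[OF sg, of x] B(1) by (auto intro: add_subgroupD[OF sg])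
      qed (simp add: add_subgroupD[OF sg])
      moreover have "m \<in> W"
        unfolding m_def using B(1) W(1) by (auto intro!: subspace_sum subspace_scale)
      ultimately show ?thesis by (auto simp: m_def)
    qed
    then have m: "m \<in> \<Lambda>" "m \<in> W" by auto
    have "norm w' \<le> (\<Sum>b\<in>B. norm (frac (c b) *\<^sub>R b))"
      unfolding w'_def by (rule norm_sum)
    also have "\<dots> \<le> M"
      unfolding M_def by (intro sum_mono) (auto simp: mult_left_le_one_le frac_ge_0 less_imp_le[OF frac_lt_1])
    finally have w'M: "norm w' \<le> M" .
    have "norm (m + l) \<le> norm (w + l) + norm w'"
      using norm_triangle_ineq4[of "w + l" w'] by (simp add: wm algebra_simps)
    then have "m + l \<in> \<Lambda> \<inter> cball 0 (M + 1)"
      using w'M n add_subgroupD(4)[OF sg m(1) l] by simp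
    moreover have "m + l \<notin> W"
      using subspace_diff[OF W(1) _ m(2), of "m + l"] lW by auto
    moreover have "- w' \<in> W"
      using subspace_diff[OF W(1) m(2) w] by (simp add: wm)
    ultimately have "d \<le> dist (m + l) (- w')"
      using d(2) by (auto simp: Q_def)
    then show False using n by (simp add: dist_norm wm algebra_simps)
  qed
  then show ?thesis using d(1) that[of "min d 1"] by auto
qed

text \<open>The functional is built up along a basis \<open>B\<close> of \<open>\<Lambda>\<close>: the coefficients of a new basis vector \<open>b\<close> on the
  subgroup form an ideal \<open>d\<int>\<close>, and adding a multiple of the coordinate along \<open>b\<close> corrects the
  functional on one element with coefficient \<open>d\<close> without changing it on the span of the
  earlier basis vectors.\<close>

lemma lattice_character_exp:
  fixes \<Lambda> H :: "'a::euclidean_space set" and ch :: "'a \<Rightarrow> complex"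
  assumes L: "full_lattice \<Lambda>" and H: "add_subgroup H" "H \<subseteq> \<Lambda>"
    and norm: "\<And>a. a \<in> H \<Longrightarrow> norm (ch a) = 1"
    and hom: "\<And>a b. a \<in> H \<Longrightarrow> b \<in> H \<Longrightarrow> ch (a + b) = ch a * ch b"
  obtains f :: "'a \<Rightarrow>\<^sub>L real"
  where "\<And>\<gamma>. \<gamma> \<in> H \<Longrightarrow> ch \<gamma> = exp (2 * of_real pi * \<i> * of_real (blinfun_apply f \<gamma>))"
proof -
  define e :: "real \<Rightarrow> complex" where "e t = exp (2 * of_real pi * \<i> * of_real t)" for t
  have e_add: "e (s + t) = e s * e t" for s t
    by (simp add: e_def algebra_simps exp_add)
  have e_nz: "e t \<noteq> 0" for t by (simp add: e_def)
  have e_diff: "e (s - t) = e s / e t" for s t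
    by (simp add: e_def algebra_simps exp_diff)
  obtain B where B: "finite B" "independent B" "span B = UNIV"
    "\<Lambda> = {\<Sum>b\<in>B. of_int (c b) *\<^sub>R b | c. True}"
    using L by (auto simp: full_lattice_def)
  have lin: "linear (\<lambda>v. representation B v b)" for b
    by (rule linearI) (auto simp: B representation_add representation_scale)
  define Z where "Z A = {\<Sum>b\<in>A. of_int (c b) *\<^sub>R b | c. True}" for A :: "'a set"
  have Zd: "a - b \<in> Z A" if ab: "a \<in> Z A" "b \<in> Z A" for a b A
  proof -
    obtain c d where "a = (\<Sum>b\<in>A. of_int (c b) *\<^sub>R b)" "b = (\<Sum>b\<in>A. of_int (d b) *\<^sub>R b)"
      using ab by (auto simp: Z_def)
    then have "a - b = (\<Sum>x\<in>A. of_int (c x - d x) *\<^sub>R x)"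
      by (simp add: sum_subtractf scaleR_diff_left)
    then show ?thesis unfolding Z_def by (intro CollectI exI[of _ "\<lambda>x. c x - d x"]) simp
  qed
  have Z0: "0 \<in> Z A" for A
    unfolding Z_def by (auto intro!: exI[of _ "\<lambda>_. 0"])
  have Z: "add_subgroup (Z A)" for A
    using Zd Z0 by (simp add: add_subgroup_def)
  have "\<exists>f. linear f \<and> (\<forall>\<gamma>\<in>H \<inter> Z A. ch \<gamma> = e (f \<gamma>))" if "A \<subseteq> B" for A
    using finite_subset[OF that B(1)] that
  proof (induction A rule: finite_induct)
    case empty
    have "ch 0 = 1"
      using hom[of 0 0] norm[of 0] add_subgroupD(1)[OF H(1)] by auto
    then show ?case
      by (intro exI[of _ "\<lambda>_. 0"]) (auto simp: Z_def e_def module_hom_zero linear_zero)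
  next
    case (insert b A)
    then obtain f where f: "linear f" "\<And>\<gamma>. \<gamma> \<in> H \<Longrightarrow> \<gamma> \<in> Z A \<Longrightarrow> ch \<gamma> = e (f \<gamma>)" by auto
    define g where "g v = representation B v b" for v
    have g: "linear g" using lin by (simp add: g_def[abs_def])
    have gb: "g b = 1"
      using insert.prems by (simp add: g_def representation_basis[OF B(2)])
    have gA: "g a = 0" if "a \<in> Z A" for a
    proof -
      have "\<exists>c::'a \<Rightarrow> int. a = (\<Sum>x\<in>A. of_int (c x) *\<^sub>R x)" using that by (simp add: Z_def)
      then obtain c where c: "a = (\<Sum>x\<in>A. of_int (c x) *\<^sub>R x)" ..
      have "g a = (\<Sum>x\<in>A. of_int (c x) * g x)"
        by (simp add: c linear_sum[OF g] linear_scale[OF g])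
      also have "\<dots> = 0"
      proof (rule sum.neutral, rule ballI)
        fix x assume "x \<in> A"
        then have "x \<in> B" "x \<noteq> b" using insert.hyps insert.prems by auto
        then show "of_int (c x) * g x = 0" by (simp add: g_def representation_basis[OF B(2)])
      qed
      finally show ?thesis .
    qed
    have split: "\<exists>k::int. \<exists>a\<in>Z A. \<gamma> = of_int k *\<^sub>R b + a" if "\<gamma> \<in> Z (insert b A)" for \<gamma>
      using that insert by (auto simp: Z_def)
    define D where "D = {k::int. \<exists>a\<in>Z A. of_int k *\<^sub>R b + a \<in> H}"
    have "add_subgroup D"
      unfolding add_subgroup_def
    proof (intro conjI ballI)
      show "0 \<in> D"
        using add_subgroupD(1)[OF H(1)] Z0 by (auto simp: D_def intro!: bexI[of _ 0])
      fix k m assume "k \<in> D" "m \<in> D"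
      then obtain a a' where a: "a \<in> Z A" "of_int k *\<^sub>R b + a \<in> H" "a' \<in> Z A" "of_int m *\<^sub>R b + a' \<in> H"
        by (auto simp: D_def)
      have "of_int (k - m) *\<^sub>R b + (a - a') \<in> H"
        using add_subgroupD(2)[OF H(1) a(2) a(4)] by (simp add: algebra_simps)
      then show "k - m \<in> D" using Zd[OF a(1) a(3)] by (auto simp: D_def)
    qed
    then obtain d where d: "d \<in> D" "\<And>k. k \<in> D \<Longrightarrow> d dvd k"
      using add_subgroup_int_principal by blast
    then obtain a0 where a0: "a0 \<in> Z A" "of_int d *\<^sub>R b + a0 \<in> H" by (auto simp: D_def)
    define h where "h = of_int d *\<^sub>R b + a0"
    have h: "h \<in> H" using a0 by (simp add: h_def)
    obtain t where t: "ch h = e t"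
    proof -
      have "ch h = cis (Arg (ch h))" using norm[OF h] cis_Arg[of "ch h"]
        by (metis div_by_1 norm_zero scaleR_one sgn_div_norm inverse_1 zero_neq_one)
      then have "ch h = e (Arg (ch h) / (2 * pi))" by (simp add: e_def cis_conv_exp)
      then show ?thesis using that by blast
    qed
    have gh: "g h = of_int d"
      by (simp add: h_def linear_add[OF g] linear_scale[OF g] gb gA a0)
    \<comment> \<open>For \<open>d = 0\<close> the quotient is zero and the functional is kept; then \<open>h\<close> is already in the
      span of the earlier basis vectors.\<close>
    define s where "s = (t - f h) / of_int d"
    define f' where "f' v = f v + s * g v" for v
    have f': "linear f'"
      unfolding f'_def[abs_def] using f(1) g by (simp add: linear_compose_add linear_compose_scale_right[of g s, simplified])
    define H' where "H' = {\<gamma>\<in>H. ch \<gamma> = e (f' \<gamma>)}"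
    have "add_subgroup H'"
      unfolding add_subgroup_def
    proof (intro conjI ballI)
      have "ch 0 = 1"
        using hom[of 0 0] norm[of 0] add_subgroupD(1)[OF H(1)] by auto
      then show "0 \<in> H'"
        using add_subgroupD(1)[OF H(1)] by (simp add: H'_def linear_0[OF f'] e_def)
      fix a c assume ac: "a \<in> H'" "c \<in> H'"
      then have "a - c \<in> H" using add_subgroupD(2)[OF H(1)] by (auto simp: H'_def)
      moreover have "ch (a - c) * ch c = ch a"
        using hom[of "a - c" c] ac calculation by (auto simp: H'_def)
      ultimately show "a - c \<in> H'"
        using ac e_nz by (auto simp: H'_def linear_diff[OF f'] e_diff field_simps)
    qed
    have A': "\<gamma> \<in> H'" if "\<gamma> \<in> H" "\<gamma> \<in> Z A" for \<gamma>
      using f(2)[OF that] gA[OF that(2)] that by (simp add: H'_def f'_def)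
    have h': "h \<in> H'"
    proof (cases "d = 0")
      case True
      then show ?thesis using A'[OF h] a0 by (simp add: h_def)
    next
      case False
      then have "f' h = t" by (simp add: f'_def gh s_def)
      then show ?thesis using h t by (simp add: H'_def)
    qed
    have "\<gamma> \<in> H'" if \<gamma>: "\<gamma> \<in> H" "\<gamma> \<in> Z (insert b A)" for \<gamma>
    proof -
      obtain k a where ka: "a \<in> Z A" "\<gamma> = of_int k *\<^sub>R b + a" using split[OF \<gamma>(2)] by blast
      then have "k \<in> D" using \<gamma>(1) by (auto simp: D_def)
      then obtain m where m: "k = d * m" using d(2) by (auto elim: dvdE)
      have eq: "\<gamma> = (a - of_int m *\<^sub>R a0) + of_int m *\<^sub>R h"
        by (simp add: ka m h_def algebra_simps)
      have mh: "of_int m *\<^sub>R h \<in> H'"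
        using add_subgroup_scale_int[OF \<open>add_subgroup H'\<close> h'] .
      have "a - of_int m *\<^sub>R a0 \<in> Z A"
        using Zd[OF ka(1) add_subgroup_scale_int[OF Z a0(1)]] .
      moreover have "a - of_int m *\<^sub>R a0 \<in> H"
      proof -
        have "\<gamma> - of_int m *\<^sub>R h \<in> H"
          using add_subgroupD(2)[OF H(1) \<gamma>(1)] mh by (auto simp: H'_def)
        then show ?thesis by (simp add: eq)
      qed
      ultimately have "a - of_int m *\<^sub>R a0 \<in> H'" using A' by blast
      then show ?thesis
        using add_subgroupD(4)[OF \<open>add_subgroup H'\<close> _ mh] eq by metis
    qed
    then show ?case using f' by (intro exI[of _ f']) (auto simp: H'_def)
  qed
  from this[of B] obtain f where f: "linear f" "\<forall>\<gamma>\<in>H \<inter> Z B. ch \<gamma> = e (f \<gamma>)" by blast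
  have "bounded_linear f" using f(1) linear_conv_bounded_linear by blast
  then have "blinfun_apply (Blinfun f) = f" by (rule bounded_linear_Blinfun_apply)
  then show ?thesis
    using f(2) H(2) B(4) by (intro that[of "Blinfun f"]) (auto simp: Z_def e_def)
qed

section \<open>Linear and alternating forms on a subspace\<close>

lemma linear_on_subspace_extends:
  fixes f :: "'a::euclidean_space \<Rightarrow> real"
  assumes W: "subspace W"
    and lin: "\<And>u v a b. u \<in> W \<Longrightarrow> v \<in> W \<Longrightarrow> f (a *\<^sub>R u + b *\<^sub>R v) = a * f u + b * f v"
  obtains g where "linear g" "\<And>u. u \<in> W \<Longrightarrow> g u = f u"
proof -
  obtain B where B: "B \<subseteq> W" "independent B" "span B = W"
    using W by (metis basis_exists span_subspace)
  then have fB: "finite B" using independent_bound by blast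
  obtain g where g: "linear g" "\<And>b. b \<in> B \<Longrightarrow> g b = f b"
    using linear_independent_extend[OF B(2)] by metis
  have "u \<in> W \<and> g u = f u" if "u \<in> span B" for u
    using that
  proof (induction rule: span_induct_alt)
    case base
    show ?case using lin[of 0 0 0 0] by (simp add: linear_0[OF g(1)] subspace_0[OF W])
  next
    case (step c x y)
    have x: "x \<in> W" using step(1) B(1) by auto
    then have "c *\<^sub>R x + y \<in> W" using step W by (simp add: subspace_add subspace_scale)
    moreover have "g (c *\<^sub>R x + y) = f (c *\<^sub>R x + y)"
      using lin[of x y c 1] x step by (simp add: linear_add[OF g(1)] linear_scale[OF g(1)] g(2))
    ultimately show ?case by blast
  qed
  then show ?thesis using that g(1) B(3) by blast
qed

lemma two_form_on_add:
  "two_form_on W \<beta> \<Longrightarrow> u \<in> W \<Longrightarrow> v \<in> W \<Longrightarrow> w \<in> W \<Longrightarrow> \<beta> (u + v) w = \<beta> u w + \<beta> v w"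
  unfolding two_form_on_def by (metis mult_1 scaleR_one)

lemma two_form_on_scale:
  assumes "two_form_on W \<beta>" "u \<in> W" "w \<in> W"
  shows "\<beta> (c *\<^sub>R u) w = c * \<beta> u w"
proof -
  have "\<beta> (c *\<^sub>R u + 0 *\<^sub>R u) w = c * \<beta> u w + 0 * \<beta> u w"
    using assms unfolding two_form_on_def by blast
  then show ?thesis by simp
qed

lemma two_form_on_skew: "two_form_on W \<beta> \<Longrightarrow> u \<in> W \<Longrightarrow> v \<in> W \<Longrightarrow> \<beta> u v = - \<beta> v u"
  unfolding two_form_on_def by blast

section \<open>The Poincare lemma for directional derivatives\<close>

text \<open>The primitive is the integral over the segment from the centre of the ball. Differentiating
  it in a direction \<open>w\<close> and using closedness turns the integrand into
  \<open>d/dt (t \<alpha>(x + t v)(w))\<close>.\<close>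

lemma closed_one_form_has_primitive:
  fixes \<alpha> :: "'a::euclidean_space \<Rightarrow> 'a \<Rightarrow> real" and \<beta> :: "'a \<Rightarrow> 'a \<Rightarrow> 'a \<Rightarrow> real"
  assumes W: "subspace W"
    and S: "S = {y \<in> ball x r. y - x \<in> W}"
    and lin: "\<And>y u v c. y \<in> S \<Longrightarrow> u \<in> W \<Longrightarrow> v \<in> W \<Longrightarrow> \<alpha> y (u + c *\<^sub>R v) = \<alpha> y u + c * \<alpha> y v"
    and der: "\<And>y u v. y \<in> S \<Longrightarrow> u \<in> W \<Longrightarrow> v \<in> W \<Longrightarrow>
      ((\<lambda>t. \<alpha> (y + t *\<^sub>R u) v) has_vector_derivative \<beta> u v y) (at 0)"
    and cont\<alpha>: "\<And>v. v \<in> W \<Longrightarrow> continuous_on S (\<lambda>y. \<alpha> y v)"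
    and cont\<beta>: "\<And>u v. u \<in> W \<Longrightarrow> v \<in> W \<Longrightarrow> continuous_on S (\<beta> u v)"
    and closed: "\<And>y u v. y \<in> S \<Longrightarrow> u \<in> W \<Longrightarrow> v \<in> W \<Longrightarrow> \<beta> u v y = \<beta> v u y"
  obtains \<phi> where "\<And>y w. y \<in> S \<Longrightarrow> w \<in> W \<Longrightarrow>
    ((\<lambda>t. \<phi> (y + t *\<^sub>R w)) has_vector_derivative \<alpha> y w) (at 0)"
proof -
  define \<phi> where "\<phi> y = integral {0..1} (\<lambda>t. \<alpha> (x + t *\<^sub>R (y - x)) (y - x))" for y
  have "((\<lambda>s. \<phi> (y + s *\<^sub>R w)) has_vector_derivative \<alpha> y w) (at 0)" if y: "y \<in> S" and w: "w \<in> W" for y w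
  proof -
    define v where "v = y - x"
    have v: "v \<in> W" "norm v < r" using y by (auto simp: S v_def dist_norm norm_minus_commute)
    define U where "U = (\<lambda>s. y + s *\<^sub>R w) -` ball x r"
    have U0: "0 \<in> U" using y by (simp add: U_def S)
    have oU: "open U" unfolding U_def by (intro open_vimage continuous_intros) auto
    have cU: "convex U"
    proof (rule convexI)
      fix s s' a b :: real assume *: "s \<in> U" "s' \<in> U" "0 \<le> a" "0 \<le> b" "a + b = 1"
      have "a *\<^sub>R (y + s *\<^sub>R w) + b *\<^sub>R (y + s' *\<^sub>R w) \<in> ball x r"
        using * by (intro convexD[OF convex_ball]) (auto simp: U_def)
      also have "a *\<^sub>R (y + s *\<^sub>R w) + b *\<^sub>R (y + s' *\<^sub>R w) = (a + b) *\<^sub>R y + (a * s + b * s') *\<^sub>R w"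
        by (simp add: algebra_simps)
      finally show "a *\<^sub>R s + b *\<^sub>R s' \<in> U" using * by (simp add: U_def)
    qed
    define p where "p s t = x + t *\<^sub>R (v + s *\<^sub>R w)" for s t :: real
    have pS: "p s t \<in> S" if "s \<in> U" "t \<in> {0..1}" for s t
    proof -
      have "norm (v + s *\<^sub>R w) < r"
        using that(1) by (simp add: U_def v_def dist_norm norm_minus_commute algebra_simps)
      moreover have "\<bar>t\<bar> * norm (v + s *\<^sub>R w) \<le> 1 * norm (v + s *\<^sub>R w)"
        using that by (intro mult_right_mono) auto
      ultimately have "norm (t *\<^sub>R (v + s *\<^sub>R w)) < r" by simp
      moreover have "t *\<^sub>R (v + s *\<^sub>R w) \<in> W"
        using W v w by (intro subspace_scale subspace_add)
      ultimately show ?thesis by (simp add: S p_def dist_norm)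
    qed
    have wW: "v + s *\<^sub>R w \<in> W" for s
      using W v w by (intro subspace_scale subspace_add)
    define f where "f s t = \<alpha> (p s t) v + s * \<alpha> (p s t) w" for s t
    define f' where "f' s t = t * \<beta> w v (p s t) + (\<alpha> (p s t) w + s * (t * \<beta> w w (p s t)))" for s t
    have f: "f s t = \<alpha> (p s t) (v + s *\<^sub>R w)" if "s \<in> U" "t \<in> {0..1}" for s t
      unfolding f_def using lin[OF pS[OF that] v(1) w] by simp
    have dp: "((\<lambda>s. \<alpha> (p s t) u) has_vector_derivative t * \<beta> w u (p s t)) (at s within U)"
      if "s \<in> U" "t \<in> {0..1}" "u \<in> W" for s t u
    proof -
      have "((\<lambda>\<tau>. \<alpha> (p s t + \<tau> *\<^sub>R w) u) has_vector_derivative \<beta> w u (p s t)) (at ((s - s) * t))"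
        using der[OF pS[OF that(1,2)] w that(3)] by simp
      moreover have "((\<lambda>s'. (s' - s) * t) has_vector_derivative t) (at s)"
        by (auto intro!: derivative_eq_intros)
      ultimately have "((\<lambda>\<tau>. \<alpha> (p s t + \<tau> *\<^sub>R w) u) \<circ> (\<lambda>s'. (s' - s) * t) has_vector_derivative t *\<^sub>R \<beta> w u (p s t)) (at s)"
        by (intro vector_diff_chain_at)
      moreover have "(\<lambda>\<tau>. \<alpha> (p s t + \<tau> *\<^sub>R w) u) \<circ> (\<lambda>s'. (s' - s) * t) = (\<lambda>s'. \<alpha> (p s' t) u)"
        by (auto simp: p_def algebra_simps)
      ultimately show ?thesis by (auto intro: has_vector_derivative_at_within)
    qed
    have df: "((\<lambda>s. f s t) has_vector_derivative f' s t) (at s within U)" if "s \<in> U" "t \<in> cbox 0 1" for s t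
    proof -
      have t: "t \<in> {0..1}" using that by simp
      have "((\<lambda>s. s * \<alpha> (p s t) w) has_vector_derivative s * (t * \<beta> w w (p s t)) + 1 * \<alpha> (p s t) w) (at s within U)"
        by (intro has_vector_derivative_mult dp that t w) (auto intro!: derivative_eq_intros)
      from has_vector_derivative_add[OF dp[OF that(1) t v(1)] this]
      show ?thesis unfolding f_def f'_def by (simp add: algebra_simps)
    qed
    have cp: "continuous_on (U \<times> {0..1}) (\<lambda>q. g (p (fst q) (snd q)))" if "continuous_on S g" for g :: "'a \<Rightarrow> real"
      by (rule continuous_on_compose2[OF that]) (auto simp: p_def intro!: continuous_intros pS[unfolded p_def])
    have cp1: "continuous_on {0..1} (\<lambda>t. g (p s t))" if "continuous_on S g" "s \<in> U" for g :: "'a \<Rightarrow> real" and s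
      by (rule continuous_on_compose2[OF that(1)]) (auto simp: p_def intro!: continuous_intros pS[unfolded p_def] that)
    have int: "f s integrable_on cbox 0 1" if "s \<in> U" for s
      unfolding f_def[abs_def]
      by (intro integrable_continuous) (auto intro!: continuous_intros cp1 cont\<alpha> v w that)
    have cf': "continuous_on (U \<times> cbox 0 1) (\<lambda>(s, t). f' s t)"
      unfolding f'_def split_beta cbox_interval
      by (intro continuous_intros cp cont\<alpha> cont\<beta> v w)
    have 1: "((\<lambda>s. integral (cbox 0 1) (f s)) has_vector_derivative integral (cbox 0 1) (f' 0)) (at 0 within U)"
      by (rule leibniz_rule_vector_derivative[OF df int cf' U0 cU])
    have px: "p 0 t = x + t *\<^sub>R v" for t by (simp add: p_def)
    have "((\<lambda>t. f' 0 t) has_integral 1 * \<alpha> (p 0 1) w - 0 * \<alpha> (p 0 0) w) {0..1}"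
    proof (rule fundamental_theorem_of_calculus)
      fix t :: real assume t: "t \<in> {0..1}"
      have "((\<lambda>\<tau>. \<alpha> (p 0 t + \<tau> *\<^sub>R v) w) has_vector_derivative \<beta> v w (p 0 t)) (at (t - t))"
        using der[OF pS[OF U0 t] v(1) w] by simp
      moreover have "((\<lambda>s. s - t) has_vector_derivative 1) (at t)"
        by (auto intro!: derivative_eq_intros)
      ultimately have "((\<lambda>\<tau>. \<alpha> (p 0 t + \<tau> *\<^sub>R v) w) \<circ> (\<lambda>s. s - t) has_vector_derivative 1 *\<^sub>R \<beta> v w (p 0 t)) (at t)"
        by (intro vector_diff_chain_at)
      moreover have "(\<lambda>\<tau>. \<alpha> (p 0 t + \<tau> *\<^sub>R v) w) \<circ> (\<lambda>s. s - t) = (\<lambda>t. \<alpha> (p 0 t) w)"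
        by (auto simp: p_def algebra_simps)
      ultimately have *: "((\<lambda>t. \<alpha> (p 0 t) w) has_vector_derivative \<beta> w v (p 0 t)) (at t)"
        by (simp add: closed[OF pS[OF U0 t] v(1) w])
      have "((\<lambda>t. t * \<alpha> (p 0 t) w) has_vector_derivative t * \<beta> w v (p 0 t) + 1 * \<alpha> (p 0 t) w) (at t)"
        by (intro has_vector_derivative_mult *) (auto intro!: derivative_eq_intros)
      then show "((\<lambda>t. t * \<alpha> (p 0 t) w) has_vector_derivative f' 0 t) (at t within {0..1})"
        unfolding f'_def by (auto intro: has_vector_derivative_at_within)
    qed simp
    then have 2: "integral (cbox 0 1) (f' 0) = \<alpha> y w"
      by (simp add: px v_def integral_unique)
    have "((\<lambda>s. \<phi> (y + s *\<^sub>R w)) has_vector_derivative \<alpha> y w) (at 0 within U)"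
    proof (rule has_vector_derivative_transform[OF U0 _ 1[unfolded 2]])
      fix s assume s: "s \<in> U"
      show "\<phi> (y + s *\<^sub>R w) = integral (cbox 0 1) (f s)"
        unfolding \<phi>_def cbox_interval
        by (rule integral_cong) (use f[OF s] in \<open>auto simp: p_def v_def algebra_simps\<close>)
    qed
    then show ?thesis using at_within_open[OF U0 oU] by simp
  qed
  then show ?thesis using that by blast
qed

section \<open>Parallel sections along a curve\<close>

lemma has_vector_derivative_within_union:
  assumes "(f has_vector_derivative d) (at x within S)" "(f has_vector_derivative d) (at x within T)"
  shows "(f has_vector_derivative d) (at x within S \<union> T)"
  using assms unfolding has_vector_derivative_def has_derivative_within by (auto intro: Lim_Un)

lemma has_vector_derivative_cis:
  assumes "(f has_vector_derivative d) (at t within S)"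
  shows "((\<lambda>t. cis (f t)) has_vector_derivative \<i> * of_real d * cis (f t)) (at t within S)"
  using has_derivative_cis[OF assms[unfolded has_vector_derivative_def]]
  unfolding has_vector_derivative_def by (rule has_derivative_eq_rhs) (auto simp: scaleR_conv_of_real mult_ac)

lemma has_vector_derivative_shift_origin:
  assumes "((\<lambda>\<tau>. f (t + \<tau>)) has_vector_derivative d) (at 0 within S)"
    and "\<And>s. s \<in> T \<Longrightarrow> s - t \<in> S"
  shows "(f has_vector_derivative d) (at t within T)"
proof -
  have "((\<lambda>\<tau>. f (t + \<tau>)) has_vector_derivative d) (at (t - t) within (\<lambda>s. s - t) ` T)"
    using assms by (auto intro: has_vector_derivative_within_subset)
  moreover have "((\<lambda>s. s - t) has_vector_derivative 1) (at t within T)"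
    by (auto intro!: derivative_eq_intros)
  ultimately have "((\<lambda>\<tau>. f (t + \<tau>)) \<circ> (\<lambda>s. s - t) has_vector_derivative 1 *\<^sub>R d) (at t within T)"
    by (intro vector_diff_chain_within)
  then show ?thesis by (simp add: o_def)
qed

text \<open>The quotient of two solutions of the same linear equation is locally constant and, because
  both transform with the same transition functions, does not depend on the frame.\<close>

lemma parallel_sections_proportional:
  fixes s s' :: "'i \<Rightarrow> real \<Rightarrow> complex" and I :: "'i \<Rightarrow> real set"
  assumes nhd: "\<And>i t. t \<in> {0..1} \<Longrightarrow> t \<in> I i \<Longrightarrow> \<forall>\<^sub>F \<tau> in at t within {0..1}. \<tau> \<in> I i"
    and cover: "\<And>t. t \<in> {0..1} \<Longrightarrow> \<exists>i. t \<in> I i"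
    and trans: "\<And>i j t. t \<in> {0..1} \<Longrightarrow> t \<in> I i \<Longrightarrow> t \<in> I j \<Longrightarrow> s i t = g i j t * s j t"
      "\<And>i j t. t \<in> {0..1} \<Longrightarrow> t \<in> I i \<Longrightarrow> t \<in> I j \<Longrightarrow> s' i t = g i j t * s' j t"
    and nz: "\<And>i t. t \<in> {0..1} \<Longrightarrow> t \<in> I i \<Longrightarrow> s i t \<noteq> 0"
    and der: "\<And>i t. t \<in> {0..1} \<Longrightarrow> t \<in> I i \<Longrightarrow> (s i has_vector_derivative l i t * s i t) (at t within {0..1})"
      "\<And>i t. t \<in> {0..1} \<Longrightarrow> t \<in> I i \<Longrightarrow> (s' i has_vector_derivative l i t * s' i t) (at t within {0..1})"
  obtains k where "\<And>i t. t \<in> {0..1} \<Longrightarrow> t \<in> I i \<Longrightarrow> s' i t = k * s i t"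
proof -
  \<comment> \<open>The choice of a frame at each \<open>t\<close> is harmless, because the quotient is the same in all frames.\<close>
  define q where "q t = s' (SOME i. t \<in> I i) t / s (SOME i. t \<in> I i) t" for t
  have q: "q t = s' i t / s i t" if "t \<in> {0..1}" "t \<in> I i" for i t
  proof -
    define j where "j = (SOME i. t \<in> I i)"
    have j: "t \<in> I j" using someI_ex[OF cover[OF that(1)]] by (simp add: j_def)
    show ?thesis
      using trans[OF that(1) j that(2)] nz[OF that(1) j]
      unfolding q_def j_def[symmetric] by auto
  qed
  have "(q has_vector_derivative 0) (at t within {0..1})" if t: "t \<in> {0..1}" for t
  proof -
    obtain i where i: "t \<in> I i" using cover[OF t] by blast
    have "((\<lambda>\<tau>. s' i \<tau> / s i \<tau>) has_derivative
        (\<lambda>h. ((h *\<^sub>R (l i t * s' i t)) * s i t - s' i t * (h *\<^sub>R (l i t * s i t))) / (s i t * s i t)))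
        (at t within {0..1})"
      using der[OF t i] nz[OF t i] unfolding has_vector_derivative_def
      by (intro has_derivative_divide') auto
    then have "((\<lambda>\<tau>. s' i \<tau> / s i \<tau>) has_vector_derivative 0) (at t within {0..1})"
      unfolding has_vector_derivative_def
      by (rule has_derivative_eq_rhs) (auto simp: algebra_simps)
    then show ?thesis
      unfolding has_vector_derivative_def
    proof (rule has_derivative_transform_eventually)
      show "\<forall>\<^sub>F \<tau> in at t within {0..1}. s' i \<tau> / s i \<tau> = q \<tau>"
        using nhd[OF t i] by (auto simp: eventually_at_filter q elim!: eventually_mono)
    qed (use q[OF t i] t in auto)
  qed
  then obtain k where k: "\<And>t. t \<in> {0..1} \<Longrightarrow> q t = k"
    using has_vector_derivative_zero_constant[of "{0..1}" q] by auto
  show ?thesis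
  proof (rule that[of k])
    fix i t assume "t \<in> {0..1::real}" "t \<in> I i"
    then show "s' i t = k * s i t" using k[of t] q[of t i] nz[of t i] by (simp add: field_simps)
  qed
qed

section \<open>Connections over an affine subtorus\<close>

lemma smooth_on_subtorusD:
  assumes sm: "smooth_on_subtorus \<Lambda> W U f" and v: "v \<in> W"
  shows "torus_proj \<Lambda> x \<in> U \<Longrightarrow>
      ((\<lambda>t. f (torus_proj \<Lambda> (x + t *\<^sub>R v))) has_vector_derivative torus_deriv v f (torus_proj \<Lambda> x)) (at 0)"
    and "continuous_on {x. torus_proj \<Lambda> x \<in> U} (\<lambda>x. f (torus_proj \<Lambda> x))"
    and "continuous_on {x. torus_proj \<Lambda> x \<in> U} (\<lambda>x. torus_deriv v f (torus_proj \<Lambda> x))"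
proof -
  have "Ck_on W {x. torus_proj \<Lambda> x \<in> U} (Suc 0) (\<lambda>x. f (torus_proj \<Lambda> x))"
    using sm unfolding smooth_on_subtorus_def smooth_along_def by blast
  moreover have "dir_deriv v (\<lambda>x. f (torus_proj \<Lambda> x)) x = torus_deriv v f (torus_proj \<Lambda> x)" for x
    by (simp add: dir_deriv_def torus_deriv_def shift_torus_proj)
  ultimately show "continuous_on {x. torus_proj \<Lambda> x \<in> U} (\<lambda>x. f (torus_proj \<Lambda> x))"
    and "continuous_on {x. torus_proj \<Lambda> x \<in> U} (\<lambda>x. torus_deriv v f (torus_proj \<Lambda> x))"
    and "torus_proj \<Lambda> x \<in> U \<Longrightarrow>
      ((\<lambda>t. f (torus_proj \<Lambda> (x + t *\<^sub>R v))) has_vector_derivative torus_deriv v f (torus_proj \<Lambda> x)) (at 0)"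
    using v by (auto simp: dir_deriv_def torus_deriv_def shift_torus_proj vector_derivative_works
        cong: continuous_on_cong)
qed

locale connection_on_subtorus =
  fixes \<Lambda> :: "'a::euclidean_space set" and C :: "'a set set" and W :: "'a set"
    and N :: "('i, 'a) line_connection" and F :: "'a \<Rightarrow> 'a \<Rightarrow> real" and x0 :: 'a
  assumes lattice: "full_lattice \<Lambda>"
    and subspace_W: "subspace W"
    and C_eq: "C = {torus_proj \<Lambda> (x0 + w) | w. w \<in> W}"
    and connection: "unitary_line_connection \<Lambda> C W N"
    and F_form: "two_form_on W F"
    and curvature_F: "\<And>i p u v. p \<in> patch N i \<Longrightarrow> u \<in> W \<Longrightarrow> v \<in> W \<Longrightarrow>
      curvature N i p u v = - 2 * of_real pi * \<i> * of_real (F u v)"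
begin

abbreviation proj :: "'a \<Rightarrow> 'a set" where "proj \<equiv> torus_proj \<Lambda>"

text \<open>Everything is pulled back along the covering \<open>x0 + W \<rightarrow> C\<close>.\<close>

definition leaf :: "'a set" where "leaf = {x. x - x0 \<in> W}"

definition chart :: "'i \<Rightarrow> 'a set" where "chart i = {x \<in> leaf. proj x \<in> patch N i}"

definition conn :: "'i \<Rightarrow> 'a \<Rightarrow> 'a \<Rightarrow> real" where "conn i x w = Im (potential N i (proj x) w)"

text \<open>A primitive of the constant form \<open>-2\<pi>F\<close>, so that \<open>d + \<i> conn - \<i> theta\<close> is a flat
  connection.\<close>

definition theta :: "'a \<Rightarrow> 'a \<Rightarrow> real" where "theta x w = - pi * F (x - x0) w"

lemma W_simps: "0 \<in> W" "u \<in> W \<Longrightarrow> v \<in> W \<Longrightarrow> u + v \<in> W" "u \<in> W \<Longrightarrow> v \<in> W \<Longrightarrow> u - v \<in> W" "u \<in> W \<Longrightarrow> c *\<^sub>R u \<in> W"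
  using subspace_W by (auto simp: subspace_0 subspace_add subspace_diff subspace_scale)

lemmas F_add_left = two_form_on_add[OF F_form]
  and F_scale_left = two_form_on_scale[OF F_form]
  and F_skew = two_form_on_skew[OF F_form]

lemma F_add_right: "u \<in> W \<Longrightarrow> v \<in> W \<Longrightarrow> w \<in> W \<Longrightarrow> F w (u + v) = F w u + F w v"
  using F_skew[of w "u + v"] F_skew[of w u] F_skew[of w v] F_add_left[of u v w] W_simps(2)[of u v] by simp

lemma F_self: "u \<in> W \<Longrightarrow> F u u = 0"
  using F_skew[of u u] by simp

lemma F_scale_right: "u \<in> W \<Longrightarrow> w \<in> W \<Longrightarrow> F w (c *\<^sub>R u) = c * F w u"
  using F_skew[of w "c *\<^sub>R u"] F_skew[of w u] F_scale_left[of u w c] W_simps(4)[of u c] by simp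

lemma leaf_add: "x \<in> leaf \<Longrightarrow> w \<in> W \<Longrightarrow> x + w \<in> leaf"
  using W_simps(2)[of "x - x0" w] by (simp add: leaf_def algebra_simps)

lemma proj_leaf: "x \<in> leaf \<Longrightarrow> proj x \<in> C"
  by (auto simp: leaf_def C_eq intro!: exI[of _ "x - x0"])

lemma proj_periodic: "\<gamma> \<in> \<Lambda> \<Longrightarrow> proj (x + \<gamma>) = proj x"
  by (simp add: torus_proj_eq_iff add_subgroup_full_lattice lattice)

lemma chart_cover: "x \<in> leaf \<Longrightarrow> \<exists>i. x \<in> chart i"
  using proj_leaf[of x] connection unfolding unitary_line_connection_def chart_def by auto

lemma chart_leaf: "x \<in> chart i \<Longrightarrow> x \<in> leaf"
  by (simp add: chart_def)

lemma chart_open: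
  assumes "x \<in> chart i"
  obtains r where "r > 0" "{y \<in> ball x r. y - x \<in> W} \<subseteq> chart i"
proof -
  obtain Y where Y: "torus_open \<Lambda> Y" "patch N i = C \<inter> Y"
    using connection unfolding unitary_line_connection_def by metis
  then have "open {v. proj v \<in> Y}" "x \<in> {v. proj v \<in> Y}"
    using assms by (auto simp: torus_open_def chart_def)
  then obtain r where r: "r > 0" "ball x r \<subseteq> {v. proj v \<in> Y}"
    using open_contains_ball by blast
  have "y \<in> leaf" if "y - x \<in> W" for y
    using leaf_add[OF chart_leaf[OF assms] that] by simp
  then show ?thesis
    using r Y(2) proj_leaf by (intro that[OF r(1)]) (auto simp: chart_def)
qed

lemma eventually_chart:
  assumes "x \<in> chart i" "w \<in> W"
  shows "\<forall>\<^sub>F t in nhds 0. x + t *\<^sub>R w \<in> chart i"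
proof -
  obtain r where r: "r > 0" "{y \<in> ball x r. y - x \<in> W} \<subseteq> chart i"
    using chart_open[OF assms(1)] by blast
  have "\<forall>\<^sub>F t in nhds 0. x + t *\<^sub>R w \<in> ball x r"
  proof -
    have "open ((\<lambda>t::real. x + t *\<^sub>R w) -` ball x r)"
      by (intro open_vimage continuous_intros) auto
    moreover have "0 \<in> (\<lambda>t::real. x + t *\<^sub>R w) -` ball x r" using r by simp
    ultimately show ?thesis
      using eventually_nhds_in_open by fastforce
  qed
  then show ?thesis
    by eventually_elim (use r W_simps(4)[OF assms(2)] in auto)
qed

lemma eventually_chart_segment:
  assumes "x + t *\<^sub>R w \<in> chart i" "w \<in> W"
  shows "\<forall>\<^sub>F \<tau> in at t within T. x + \<tau> *\<^sub>R w \<in> chart i"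
proof -
  have "filterlim (\<lambda>\<tau>. \<tau> - t) (nhds (t - t)) (at t within T)"
    by (intro tendsto_intros)
  then have "\<forall>\<^sub>F \<tau> in at t within T. (x + t *\<^sub>R w) + (\<tau> - t) *\<^sub>R w \<in> chart i"
    using eventually_chart[OF assms] eventually_compose_filterlim by fastforce
  then show ?thesis by (simp add: algebra_simps)
qed

lemma trans_facts:
  shows "x \<in> chart i \<Longrightarrow> x \<in> chart j \<Longrightarrow> norm (trans N i j (proj x)) = 1"
    and "x \<in> chart i \<Longrightarrow> x \<in> chart j \<Longrightarrow> x \<in> chart k \<Longrightarrow>
      trans N i j (proj x) * trans N j k (proj x) = trans N i k (proj x)"
  using connection unfolding unitary_line_connection_def chart_def by auto

lemma trans_deriv:
  assumes "x \<in> chart i" "x \<in> chart j" "w \<in> W"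
  shows "((\<lambda>t. trans N i j (proj (x + t *\<^sub>R w))) has_vector_derivative
    \<i> * of_real (conn j x w - conn i x w) * trans N i j (proj x)) (at 0)"
proof -
  have p: "proj x \<in> patch N i \<inter> patch N j" using assms by (simp add: chart_def)
  have "smooth_on_subtorus \<Lambda> W (patch N i \<inter> patch N j) (trans N i j)"
    using connection unfolding unitary_line_connection_def by simp
  note d = smooth_on_subtorusD(1)[OF this assms(3) p]
  have "torus_deriv w (trans N i j) (proj x) = trans N i j (proj x) * (potential N j (proj x) w - potential N i (proj x) w)"
    using connection p assms(3) unfolding unitary_line_connection_def by blast
  moreover have "Re (potential N k (proj x) w) = 0" if "k = i \<or> k = j" for k
    using connection p assms(3) that unfolding unitary_line_connection_def by blast
  then have "potential N j (proj x) w - potential N i (proj x) w = \<i> * of_real (conn j x w - conn i x w)"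
    by (simp add: complex_eq_iff conn_def)
  ultimately show ?thesis using d by (simp add: mult.commute)
qed

lemma potential_conn:
  assumes "x \<in> chart i" "w \<in> W"
  shows "potential N i (proj x) w = \<i> * of_real (conn i x w)"
proof -
  have "Re (potential N i (proj x) w) = 0"
    using connection assms unfolding unitary_line_connection_def chart_def by blast
  then show ?thesis by (simp add: complex_eq_iff conn_def)
qed

lemma conn_linear:
  assumes "x \<in> chart i" "u \<in> W" "v \<in> W"
  shows "conn i x (u + c *\<^sub>R v) = conn i x u + c * conn i x v"
proof -
  have "potential N i (proj x) (1 *\<^sub>R u + c *\<^sub>R v) = 1 *\<^sub>R potential N i (proj x) u + c *\<^sub>R potential N i (proj x) v"
    using connection assms unfolding unitary_line_connection_def chart_def by blast
  then show ?thesis by (simp add: conn_def)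
qed

definition conn_deriv :: "'i \<Rightarrow> 'a \<Rightarrow> 'a \<Rightarrow> 'a \<Rightarrow> real" where
  "conn_deriv i u v x = Im (torus_deriv u (\<lambda>p. potential N i p v) (proj x))"

lemma conn_C1:
  assumes "u \<in> W" "v \<in> W"
  shows "x \<in> chart i \<Longrightarrow> ((\<lambda>t. conn i (x + t *\<^sub>R u) v) has_vector_derivative conn_deriv i u v x) (at 0)"
    and "continuous_on (chart i) (\<lambda>x. conn i x v)"
    and "continuous_on (chart i) (conn_deriv i u v)"
proof -
  have sm: "smooth_on_subtorus \<Lambda> W (patch N i) (\<lambda>p. potential N i p v)"
    using connection assms unfolding unitary_line_connection_def by blast
  have sub: "chart i \<subseteq> {x. proj x \<in> patch N i}" by (auto simp: chart_def)
  show "((\<lambda>t. conn i (x + t *\<^sub>R u) v) has_vector_derivative conn_deriv i u v x) (at 0)" if "x \<in> chart i"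
    unfolding conn_def conn_deriv_def
    using that sub smooth_on_subtorusD(1)[OF sm assms(1)]
    by (intro bounded_linear.has_vector_derivative[OF bounded_linear_Im]) auto
  show "continuous_on (chart i) (\<lambda>x. conn i x v)"
    unfolding conn_def
    by (intro continuous_intros continuous_on_subset[OF smooth_on_subtorusD(2)[OF sm assms(1)] sub])
  show "continuous_on (chart i) (conn_deriv i u v)"
    unfolding conn_deriv_def[abs_def]
    by (intro continuous_intros continuous_on_subset[OF smooth_on_subtorusD(3)[OF sm assms(1)] sub])
qed

lemma conn_curvature:
  assumes "x \<in> chart i" "u \<in> W" "v \<in> W"
  shows "conn_deriv i u v x - conn_deriv i v u x = - 2 * pi * F u v"
proof -
  have "Im (curvature N i (proj x) u v) = - 2 * pi * F u v"
    using curvature_F[of "proj x" i u v] assms by (simp add: chart_def)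
  then show ?thesis by (simp add: curvature_def conn_deriv_def)
qed

lemma F_extends:
  assumes "w \<in> W"
  obtains g where "bounded_linear g" "\<And>u. u \<in> W \<Longrightarrow> g u = F u w"
proof -
  obtain g where g: "linear g" "\<And>u. u \<in> W \<Longrightarrow> g u = F u w"
    using linear_on_subspace_extends[OF subspace_W, of "\<lambda>u. F u w"] assms F_add_left F_scale_left W_simps
    by (metis (no_types, lifting))
  then show ?thesis using that linear_conv_bounded_linear by blast
qed

lemma continuous_F:
  assumes "w \<in> W"
  shows "continuous_on leaf (\<lambda>x. F (x - x0) w)"
proof -
  obtain g where g: "bounded_linear g" "\<And>u. u \<in> W \<Longrightarrow> g u = F u w"
    using F_extends[OF assms] by blast
  have "continuous_on leaf (\<lambda>x. g (x - x0))"
    by (intro bounded_linear.continuous_on[OF g(1)] continuous_intros)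
  then show ?thesis
    by (rule continuous_on_eq) (auto simp: leaf_def g(2))
qed

end

section \<open>Flat sections of the twisted connection\<close>

context connection_on_subtorus
begin

text \<open>A unit parallel section of the flat connection \<open>d + \<i> (conn - theta)\<close>, in all frames of \<open>N\<close>. The
  derivatives are taken within \<open>K\<close>, so that sections over closed pieces can be glued.\<close>

definition flat_section :: "'a set \<Rightarrow> ('i \<Rightarrow> 'a \<Rightarrow> complex) \<Rightarrow> bool" where
  "flat_section K \<sigma> \<longleftrightarrow>
     (\<forall>i. \<forall>x \<in> K \<inter> chart i. norm (\<sigma> i x) = 1) \<and>
     (\<forall>i j. \<forall>x \<in> K \<inter> chart i \<inter> chart j. \<sigma> i x = trans N i j (proj x) * \<sigma> j x) \<and>
     (\<forall>i. \<forall>x \<in> K \<inter> chart i. \<forall>w\<in>W. ((\<lambda>t. \<sigma> i (x + t *\<^sub>R w)) has_vector_derivative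
        \<i> * of_real (theta x w - conn i x w) * \<sigma> i x) (at 0 within {t. x + t *\<^sub>R w \<in> K}))"

lemma flat_sectionD:
  assumes "flat_section K \<sigma>" "x \<in> K" "x \<in> chart i"
  shows "norm (\<sigma> i x) = 1" "x \<in> chart j \<Longrightarrow> \<sigma> i x = trans N i j (proj x) * \<sigma> j x"
    "w \<in> W \<Longrightarrow> ((\<lambda>t. \<sigma> i (x + t *\<^sub>R w)) has_vector_derivative
        \<i> * of_real (theta x w - conn i x w) * \<sigma> i x) (at 0 within {t. x + t *\<^sub>R w \<in> K})"
  using assms unfolding flat_section_def by blast+

lemma flat_section_subset:
  assumes "flat_section K \<sigma>" "K' \<subseteq> K"
  shows "flat_section K' \<sigma>"
  unfolding flat_section_def
proof (intro conjI allI ballI)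
  fix i x w assume "x \<in> K' \<inter> chart i" "w \<in> W"
  then show "((\<lambda>t. \<sigma> i (x + t *\<^sub>R w)) has_vector_derivative
        \<i> * of_real (theta x w - conn i x w) * \<sigma> i x) (at 0 within {t. x + t *\<^sub>R w \<in> K'})"
    using assms(2) by (intro has_vector_derivative_within_subset[OF flat_sectionD(3)[OF assms(1)]]) auto
next
  fix i j x assume "x \<in> K' \<inter> chart i \<inter> chart j"
  then show "\<sigma> i x = trans N i j (proj x) * \<sigma> j x"
    using assms(2) flat_sectionD(2)[OF assms(1), of x i j] by blast
qed (use assms flat_sectionD(1)[OF assms(1)] in auto)

lemma flat_section_along_segment:
  assumes \<sigma>: "flat_section K \<sigma>" and K: "\<And>t. t \<in> {0..1} \<Longrightarrow> x + t *\<^sub>R w \<in> K"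
    and w: "w \<in> W" and t: "t \<in> {0..1}" and i: "x + t *\<^sub>R w \<in> chart i"
  shows "((\<lambda>t. \<sigma> i (x + t *\<^sub>R w)) has_vector_derivative
    \<i> * of_real (theta (x + t *\<^sub>R w) w - conn i (x + t *\<^sub>R w) w) * \<sigma> i (x + t *\<^sub>R w)) (at t within {0..1})"
proof (rule has_vector_derivative_shift_origin)
  show "((\<lambda>\<tau>. \<sigma> i (x + (t + \<tau>) *\<^sub>R w)) has_vector_derivative
    \<i> * of_real (theta (x + t *\<^sub>R w) w - conn i (x + t *\<^sub>R w) w) * \<sigma> i (x + t *\<^sub>R w))
    (at 0 within {\<tau>. x + t *\<^sub>R w + \<tau> *\<^sub>R w \<in> K})"
    using flat_sectionD(3)[OF \<sigma> K[OF t] i w] by (simp add: scaleR_add_left add.assoc)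
qed (use K in \<open>simp add: algebra_simps\<close>)

text \<open>Any two points of \<open>K\<close> are joined by a segment, along which both sections solve the same
  equation.\<close>

lemma flat_section_unique:
  assumes \<sigma>: "flat_section K \<sigma>" and \<sigma>': "flat_section K \<sigma>'" and K: "convex K" "K \<subseteq> leaf"
  obtains c where "norm c = 1" "\<And>i x. x \<in> K \<Longrightarrow> x \<in> chart i \<Longrightarrow> \<sigma>' i x = c * \<sigma> i x"
proof (cases "K = {}")
  case True
  then show ?thesis using that[of 1] by auto
next
  case False
  then obtain y where y: "y \<in> K" by blast
  obtain i0 where i0: "y \<in> chart i0" using y K(2) chart_cover by blast
  define c where "c = \<sigma>' i0 y / \<sigma> i0 y"
  have c: "norm c = 1"
    using flat_sectionD(1)[OF \<sigma> y i0] flat_sectionD(1)[OF \<sigma>' y i0] by (simp add: c_def norm_divide)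
  have "\<sigma>' i x = c * \<sigma> i x" if x: "x \<in> K" "x \<in> chart i" for i x
  proof -
    define w where "w = x - y"
    have w: "w \<in> W"
      using x(1) y K(2) W_simps(3)[of "x - x0" "y - x0"] by (auto simp: leaf_def w_def)
    have seg: "y + t *\<^sub>R w \<in> K" if "t \<in> {0..1}" for t
    proof -
      have "(1 - t) *\<^sub>R y + t *\<^sub>R x \<in> K" using that K(1) y x(1) by (intro convexD) auto
      then show ?thesis by (simp add: w_def algebra_simps)
    qed
    obtain k where k: "\<And>i t. t \<in> {0..1} \<Longrightarrow> y + t *\<^sub>R w \<in> chart i \<Longrightarrow> \<sigma>' i (y + t *\<^sub>R w) = k * \<sigma> i (y + t *\<^sub>R w)"
    proof (rule parallel_sections_proportional[where I="\<lambda>i. {t. y + t *\<^sub>R w \<in> chart i}"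
          and s="\<lambda>i t. \<sigma> i (y + t *\<^sub>R w)" and s'="\<lambda>i t. \<sigma>' i (y + t *\<^sub>R w)"
          and l="\<lambda>i t. \<i> * of_real (theta (y + t *\<^sub>R w) w - conn i (y + t *\<^sub>R w) w)"
          and g="\<lambda>i j t. trans N i j (proj (y + t *\<^sub>R w))"], goal_cases)
      case (1 t i)
      then show ?case using eventually_chart_segment[OF _ w] by simp
    next
      case (2 t)
      then show ?case using chart_cover[of "y + t *\<^sub>R w"] seg K(2) by auto
    next
      case (3 i j t)
      then show ?case by (intro flat_sectionD(2)[OF \<sigma> seg]) auto
    next
      case (4 i j t)
      then show ?case by (intro flat_sectionD(2)[OF \<sigma>' seg]) auto
    next
      case (5 i t)
      then show ?case using flat_sectionD(1)[OF \<sigma> seg, of t i] by auto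
    next
      case (6 i t)
      then show ?case using flat_section_along_segment[OF \<sigma> seg w] by simp
    next
      case (7 i t)
      then show ?case using flat_section_along_segment[OF \<sigma>' seg w] by simp
    next
      case (8 k)
      then show ?case by (intro 8(1)[of k] 8(2)) auto
    qed
    have "\<sigma>' i0 y = k * \<sigma> i0 y" using k[of 0 i0] i0 by simp
    then have "k = c" using flat_sectionD(1)[OF \<sigma> y i0] by (auto simp: c_def)
    then show ?thesis using k[of 1 i] x(2) by (simp add: w_def)
  qed
  then show ?thesis using that c by blast
qed

text \<open>Near a point the flat connection has closed connection form in one frame, and a flat section is
  the exponential of a primitive, transported to the other frames by the transition functions.\<close>

lemma flat_section_local:
  assumes x: "x \<in> leaf"
  obtains r \<sigma> where "r > 0" "flat_section {y \<in> ball x r. y - x \<in> W} \<sigma>"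
proof -
  obtain i where i: "x \<in> chart i" using chart_cover[OF x] by blast
  obtain r where r: "r > 0" "{y \<in> ball x r. y - x \<in> W} \<subseteq> chart i"
    using chart_open[OF i] by blast
  define S where "S = {y \<in> ball x r. y - x \<in> W}"
  have Si: "S \<subseteq> chart i" using r by (simp add: S_def)
  have Sl: "S \<subseteq> leaf" using Si chart_leaf by blast
  define \<alpha> where "\<alpha> y w = theta y w - conn i y w" for y w
  define \<beta> where "\<beta> u v y = - pi * F u v - conn_deriv i u v y" for u v y
  obtain \<phi> where \<phi>: "\<And>y w. y \<in> S \<Longrightarrow> w \<in> W \<Longrightarrow>
    ((\<lambda>t. \<phi> (y + t *\<^sub>R w)) has_vector_derivative \<alpha> y w) (at 0)"
  proof (rule closed_one_form_has_primitive[OF subspace_W S_def, of \<alpha> \<beta>], goal_cases)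
    case (1 y u v c)
    then have "y \<in> chart i" "y - x0 \<in> W" using Si Sl by (auto simp: leaf_def)
    then show ?case
      using 1 by (simp add: \<alpha>_def theta_def conn_linear F_add_right F_scale_right W_simps algebra_simps)
  next
    case (2 y u v)
    then have y: "y \<in> chart i" "y - x0 \<in> W" using Si Sl by (auto simp: leaf_def)
    have "theta (y + t *\<^sub>R u) v = theta y v + t * (- pi * F u v)" for t
      using y 2 F_add_left[of "y - x0" "t *\<^sub>R u" v]
      by (simp add: theta_def F_scale_left W_simps algebra_simps)
    moreover have "((\<lambda>t. theta y v + t * (- pi * F u v)) has_vector_derivative - pi * F u v) (at 0)"
      by (auto intro!: derivative_eq_intros)
    ultimately have "((\<lambda>t. theta (y + t *\<^sub>R u) v) has_vector_derivative - pi * F u v) (at 0)"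
      by simp
    then show ?case
      unfolding \<alpha>_def \<beta>_def using conn_C1(1)[OF 2(3,4) y(1)] by (rule has_vector_derivative_diff)
  next
    case (3 v)
    show ?case
      unfolding \<alpha>_def theta_def
      by (intro continuous_intros continuous_on_subset[OF continuous_F[OF 3(2)] Sl]
          continuous_on_subset[OF conn_C1(2)[OF 3(2) 3(2)] Si])
  next
    case (4 u v)
    show ?case
      unfolding \<beta>_def by (intro continuous_intros continuous_on_subset[OF conn_C1(3)[OF 4(2,3)] Si])
  next
    case (5 y u v)
    then show ?case
      using conn_curvature[of y i u v] F_skew[of u v] Si by (auto simp: \<beta>_def)
  next
    case (6 \<phi>)
    then show ?case by blast
  qed
  define \<sigma> where "\<sigma> j y = trans N j i (proj y) * cis (\<phi> y)" for j y
  have "flat_section S \<sigma>"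
    unfolding flat_section_def
  proof (intro conjI allI ballI)
    fix j y assume "y \<in> S \<inter> chart j"
    then show "norm (\<sigma> j y) = 1"
      using Si trans_facts(1)[of y j i] by (auto simp: \<sigma>_def norm_mult)
  next
    fix j k y assume "y \<in> S \<inter> chart j \<inter> chart k"
    then show "\<sigma> j y = trans N j k (proj y) * \<sigma> k y"
      using Si trans_facts(2)[of y j k i] by (auto simp: \<sigma>_def)
  next
    fix j y w assume y: "y \<in> S \<inter> chart j" and w: "w \<in> W"
    have 1: "((\<lambda>t. trans N j i (proj (y + t *\<^sub>R w))) has_vector_derivative
        \<i> * of_real (conn i y w - conn j y w) * trans N j i (proj y)) (at 0)"
      using y Si by (intro trans_deriv w) auto
    have 2: "((\<lambda>t. cis (\<phi> (y + t *\<^sub>R w))) has_vector_derivative \<i> * of_real (\<alpha> y w) * cis (\<phi> y)) (at 0)"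
      using has_vector_derivative_cis[OF \<phi>[OF _ w, of y]] y by simp
    from has_vector_derivative_mult[OF 1 2]
    have "((\<lambda>t. \<sigma> j (y + t *\<^sub>R w)) has_vector_derivative \<i> * of_real (theta y w - conn j y w) * \<sigma> j y) (at 0)"
      by (simp add: \<sigma>_def \<alpha>_def algebra_simps)
    then show "((\<lambda>t. \<sigma> j (y + t *\<^sub>R w)) has_vector_derivative \<i> * of_real (theta y w - conn j y w) * \<sigma> j y)
        (at 0 within {t. y + t *\<^sub>R w \<in> S})"
      by (rule has_vector_derivative_at_within)
  qed
  then show ?thesis using that r(1) by (simp add: S_def)
qed

lemma flat_section_cong:
  assumes "flat_section K \<sigma>" and "\<And>i x. x \<in> K \<Longrightarrow> x \<in> chart i \<Longrightarrow> \<sigma>' i x = c * \<sigma> i x" and "norm c = 1"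
  shows "flat_section K \<sigma>'"
  unfolding flat_section_def
proof (intro conjI allI ballI)
  fix i x assume "x \<in> K \<inter> chart i"
  then show "norm (\<sigma>' i x) = 1" using assms flat_sectionD(1)[OF assms(1)] by (simp add: norm_mult)
next
  fix i j x assume "x \<in> K \<inter> chart i \<inter> chart j"
  then show "\<sigma>' i x = trans N i j (proj x) * \<sigma>' j x"
    using assms(2) flat_sectionD(2)[OF assms(1), of x i j] by simp
next
  fix i x w assume x: "x \<in> K \<inter> chart i" and w: "w \<in> W"
  have "((\<lambda>t. c * \<sigma> i (x + t *\<^sub>R w)) has_vector_derivative c * (\<i> * of_real (theta x w - conn i x w) * \<sigma> i x))
      (at 0 within {t. x + t *\<^sub>R w \<in> K})"
    using flat_sectionD(3)[OF assms(1) _ _ w] x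
    by (intro bounded_linear.has_vector_derivative[OF bounded_linear_mult_right]) auto
  moreover have "\<forall>\<^sub>F t in at 0 within {t. x + t *\<^sub>R w \<in> K}. c * \<sigma> i (x + t *\<^sub>R w) = \<sigma>' i (x + t *\<^sub>R w)"
    using eventually_chart[of x i w] x w assms(2)
    by (auto simp: eventually_at_filter elim!: eventually_mono)
  ultimately show "((\<lambda>t. \<sigma>' i (x + t *\<^sub>R w)) has_vector_derivative \<i> * of_real (theta x w - conn i x w) * \<sigma>' i x)
      (at 0 within {t. x + t *\<^sub>R w \<in> K})"
    using x assms(2)[of x i] unfolding has_vector_derivative_def
    by (auto intro: has_derivative_transform_eventually simp: mult_ac)
qed

text \<open>Over two halves of a convex set, flat sections can be normalised to agree on the common
  hyperplane section, which is convex; the derivatives within the two halves then combine.\<close>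

lemma flat_section_glue:
  assumes K: "convex K" "K \<subseteq> leaf"
    and \<sigma>1: "flat_section (K \<inter> {x. x \<bullet> b \<le> m}) \<sigma>1"
    and \<sigma>2: "flat_section (K \<inter> {x. x \<bullet> b \<ge> m}) \<sigma>2"
  shows "\<exists>\<sigma>. flat_section K \<sigma>"
proof -
  define K1 where "K1 = K \<inter> {x. x \<bullet> b \<le> m}"
  define K2 where "K2 = K \<inter> {x. x \<bullet> b \<ge> m}"
  have cv: "convex (K1 \<inter> K2)"
    unfolding K1_def K2_def inner_commute[of _ b]
    by (intro convex_Int K convex_halfspace_le convex_halfspace_ge)
  have "flat_section (K1 \<inter> K2) \<sigma>1" "flat_section (K1 \<inter> K2) \<sigma>2"
    using \<sigma>1 \<sigma>2 by (auto intro: flat_section_subset simp: K1_def K2_def)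
  then obtain c where c: "norm c = 1" "\<And>i x. x \<in> K1 \<inter> K2 \<Longrightarrow> x \<in> chart i \<Longrightarrow> \<sigma>2 i x = c * \<sigma>1 i x"
    using flat_section_unique[OF _ _ cv, of \<sigma>1 \<sigma>2] K(2) by (metis IntD1 K1_def subsetD subsetI)
  define \<sigma> where "\<sigma> i x = (if x \<bullet> b \<le> m then c * \<sigma>1 i x else \<sigma>2 i x)" for i x
  have f1: "flat_section K1 \<sigma>"
    by (rule flat_section_cong[OF \<sigma>1[folded K1_def] _ c(1)]) (auto simp: \<sigma>_def K1_def)
  have f2: "flat_section K2 \<sigma>"
  proof (rule flat_section_cong[OF \<sigma>2[folded K2_def], of _ 1])
    fix i x assume "x \<in> K2" "x \<in> chart i"
    then show "\<sigma> i x = 1 * \<sigma>2 i x" using c(2)[of x i] by (auto simp: \<sigma>_def K1_def K2_def)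
  qed simp
  have "flat_section K \<sigma>"
    unfolding flat_section_def
  proof (intro conjI allI ballI)
    fix i x assume "x \<in> K \<inter> chart i"
    then show "norm (\<sigma> i x) = 1"
      using flat_sectionD(1)[OF f1, of x i] flat_sectionD(1)[OF f2, of x i] linear[of "x \<bullet> b" m]
      by (auto simp: K1_def K2_def)
  next
    fix i j x assume "x \<in> K \<inter> chart i \<inter> chart j"
    then show "\<sigma> i x = trans N i j (proj x) * \<sigma> j x"
      using flat_sectionD(2)[OF f1, of x i j] flat_sectionD(2)[OF f2, of x i j] linear[of "x \<bullet> b" m]
      by (auto simp: K1_def K2_def)
  next
    fix i x w assume x: "x \<in> K \<inter> chart i" and w: "w \<in> W"
    let ?d = "\<lambda>T. ((\<lambda>t. \<sigma> i (x + t *\<^sub>R w)) has_vector_derivative \<i> * of_real (theta x w - conn i x w) * \<sigma> i x) (at 0 within T)"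
    \<comment> \<open>Away from the closure of \<open>T\<close> the condition within \<open>T\<close> is void, so a point of only one half
      needs no separate argument.\<close>
    have far: "?d T" if "0 \<notin> closure T" for T
    proof -
      have "at 0 within T = bot"
        using that by (metis closure_def UnI2 mem_Collect_eq trivial_limit_within)
      then show ?thesis
        by (simp add: has_vector_derivative_def has_derivative_def bounded_linear_scaleR_left)
    qed
    have cl: "closed {t. (x + t *\<^sub>R w) \<bullet> b \<le> m}" "closed {t. (x + t *\<^sub>R w) \<bullet> b \<ge> m}"
      by (intro closed_Collect_le continuous_intros)+
    have "?d {t. x + t *\<^sub>R w \<in> K1}"
    proof (cases "x \<in> K1")
      case True
      then show ?thesis using flat_sectionD(3)[OF f1] x w by blast
    next
      case False
      have "closure {t. x + t *\<^sub>R w \<in> K1} \<subseteq> {t. (x + t *\<^sub>R w) \<bullet> b \<le> m}"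
        by (intro closure_minimal cl) (auto simp: K1_def)
      then show ?thesis using False x by (intro far) (auto simp: K1_def)
    qed
    moreover have "?d {t. x + t *\<^sub>R w \<in> K2}"
    proof (cases "x \<in> K2")
      case True
      then show ?thesis using flat_sectionD(3)[OF f2] x w by blast
    next
      case False
      have "closure {t. x + t *\<^sub>R w \<in> K2} \<subseteq> {t. (x + t *\<^sub>R w) \<bullet> b \<ge> m}"
        by (intro closure_minimal cl) (auto simp: K2_def)
      then show ?thesis using False x by (intro far) (auto simp: K2_def)
    qed
    ultimately have "?d ({t. x + t *\<^sub>R w \<in> K1} \<union> {t. x + t *\<^sub>R w \<in> K2})"
      by (rule has_vector_derivative_within_union)
    moreover have "{t. x + t *\<^sub>R w \<in> K1} \<union> {t. x + t *\<^sub>R w \<in> K2} = {t. x + t *\<^sub>R w \<in> K}"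
      by (auto simp: K1_def K2_def)
    ultimately show "?d {t. x + t *\<^sub>R w \<in> K}" by simp
  qed
  then show ?thesis by blast
qed

text \<open>By compactness, convex pieces of small width in all coordinate directions carry flat sections;
  gluing parallel slabs removes the width bound in one coordinate direction after the other.\<close>

lemma flat_section_exists: "\<exists>\<sigma>. flat_section (leaf \<inter> cball 0 R) \<sigma>"
proof -
  define K0 where "K0 = leaf \<inter> cball 0 R"
  have leaf_alt: "leaf = (\<lambda>w. x0 + w) ` W"
    by (auto simp: leaf_def image_iff intro!: bexI[of _ "_ - x0"])
  have "closed leaf"
    unfolding leaf_alt using closed_translation[OF closed_subspace[OF subspace_W]] .
  then have K0: "compact K0" by (simp add: K0_def closed_Int_compact)
  have "convex leaf"
    unfolding leaf_alt using convex_translation[OF subspace_imp_convex[OF subspace_W]] .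
  then have K0cv: "convex K0" by (simp add: K0_def convex_Int)
  have "\<forall>x\<in>leaf. \<exists>r. r > 0 \<and> (\<exists>\<sigma>. flat_section {y \<in> ball x r. y - x \<in> W} \<sigma>)"
    using flat_section_local by metis
  then obtain r where r: "\<And>x. x \<in> leaf \<Longrightarrow> r x > 0"
    "\<And>x. x \<in> leaf \<Longrightarrow> \<exists>\<sigma>. flat_section {y \<in> ball x (r x). y - x \<in> W} \<sigma>"
    by metis
  obtain \<delta> where \<delta>: "\<delta> > 0" "\<And>x. x \<in> K0 \<Longrightarrow> \<exists>G\<in>(\<lambda>x. ball x (r x)) ` K0. ball x \<delta> \<subseteq> G"
  proof (rule Heine_Borel_lemma[OF K0, of "(\<lambda>x. ball x (r x)) ` K0"])
    show "K0 \<subseteq> \<Union> ((\<lambda>x. ball x (r x)) ` K0)" using r(1) by (force simp: K0_def)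
  qed (auto intro: that)
  \<comment> \<open>A set of width at most \<open>\<epsilon>\<close> in all coordinates has diameter less than the Lebesgue number \<open>\<delta>\<close>.\<close>
  define \<epsilon> where "\<epsilon> = \<delta> / (2 * real DIM('a))"
  have \<epsilon>: "\<epsilon> > 0" using \<delta> by (simp add: \<epsilon>_def)
  have small: "\<exists>\<sigma>. flat_section K \<sigma>"
    if K: "K \<subseteq> K0" and width: "\<And>b x y. b \<in> Basis \<Longrightarrow> x \<in> K \<Longrightarrow> y \<in> K \<Longrightarrow> \<bar>x \<bullet> b - y \<bullet> b\<bar> \<le> \<epsilon>" for K
  proof (cases "K = {}")
    case True
    then show ?thesis by (simp add: flat_section_def)
  next
    case False
    then obtain y where y: "y \<in> K" by blast
    then obtain x where x: "x \<in> K0" "ball y \<delta> \<subseteq> ball x (r x)" using \<delta>(2)[of y] K by blast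
    have "K \<subseteq> {z \<in> ball x (r x). z - x \<in> W}"
    proof
      fix z assume z: "z \<in> K"
      have "norm (y - z) \<le> (\<Sum>b\<in>Basis. \<bar>(y - z) \<bullet> b\<bar>)" by (rule norm_le_l1)
      also have "\<dots> \<le> (\<Sum>b\<in>(Basis :: 'a set). \<epsilon>)"
        using width[OF _ y z] by (intro sum_mono) (simp add: inner_diff_left)
      also have "\<dots> < \<delta>" using \<delta>(1) by (simp add: \<epsilon>_def)
      finally have "z \<in> ball x (r x)" using x(2) by (auto simp: dist_norm)
      moreover have "z - x \<in> W"
        using W_simps(3)[of "z - x0" "x - x0"] z x(1) K by (auto simp: K0_def leaf_def)
      ultimately show "z \<in> {z \<in> ball x (r x). z - x \<in> W}" by simp
    qed
    moreover have "x \<in> leaf" using x(1) by (simp add: K0_def)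
    ultimately show ?thesis using r(2)[of x] flat_section_subset by blast
  qed
  \<comment> \<open>\<open>D\<close> is the set of coordinate directions in which the width is no longer bounded by \<open>\<epsilon>\<close>.\<close>
  have "\<exists>\<sigma>. flat_section K \<sigma>"
    if "finite D" "convex K" "K \<subseteq> K0"
      "\<And>b x y. b \<in> Basis - D \<Longrightarrow> x \<in> K \<Longrightarrow> y \<in> K \<Longrightarrow> \<bar>x \<bullet> b - y \<bullet> b\<bar> \<le> \<epsilon>" for D K
    using that
  proof (induction D arbitrary: K rule: finite_induct)
    case empty
    then show ?case using small by simp
  next
    case (insert b D)
    note IH = insert.IH
    have slab: "\<exists>\<sigma>. flat_section K \<sigma>"
      if "convex K" "K \<subseteq> K0"
        "\<And>b' x y. b' \<in> Basis - insert b D \<Longrightarrow> x \<in> K \<Longrightarrow> y \<in> K \<Longrightarrow> \<bar>x \<bullet> b' - y \<bullet> b'\<bar> \<le> \<epsilon>"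
        "\<And>x. x \<in> K \<Longrightarrow> lo \<le> x \<bullet> b \<and> x \<bullet> b \<le> lo + real n * \<epsilon>" for n lo K
      using that
    proof (induction n arbitrary: K)
      case 0
      have "\<bar>x \<bullet> b' - y \<bullet> b'\<bar> \<le> \<epsilon>" if "b' \<in> Basis - D" "x \<in> K" "y \<in> K" for b' x y
        using 0(3)[of b' x y] 0(4)[of x] 0(4)[of y] that \<epsilon> by (cases "b' = b") auto
      then show ?case using IH[OF 0(1,2)] by blast
    next
      case (Suc n)
      define m where "m = lo + real n * \<epsilon>"
      have cv: "convex (K \<inter> {x. x \<bullet> b \<le> m})" "convex (K \<inter> {x. x \<bullet> b \<ge> m})"
        unfolding inner_commute[of _ b]
        by (intro convex_Int Suc.prems convex_halfspace_le convex_halfspace_ge)+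
      have 1: "\<exists>\<sigma>. flat_section (K \<inter> {x. x \<bullet> b \<le> m}) \<sigma>"
        using Suc.prems by (intro Suc.IH cv) (auto simp: m_def)
      have "\<exists>\<sigma>. flat_section (K \<inter> {x. x \<bullet> b \<ge> m}) \<sigma>"
      proof (rule IH[OF cv(2)])
        fix b' x y assume *: "b' \<in> Basis - D" "x \<in> K \<inter> {x. m \<le> x \<bullet> b}" "y \<in> K \<inter> {x. m \<le> x \<bullet> b}"
        then show "\<bar>x \<bullet> b' - y \<bullet> b'\<bar> \<le> \<epsilon>"
          using Suc.prems(3)[of b' x y] Suc.prems(4)[of x] Suc.prems(4)[of y]
          by (cases "b' = b") (auto simp: m_def algebra_simps)
      qed (use Suc.prems in auto)
      then show ?case
        using 1 flat_section_glue[OF Suc.prems(1), of b m] Suc.prems(2) by (auto simp: K0_def)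
    qed
    define M where "M = \<bar>R\<bar> * norm b"
    obtain n where n: "2 * M < real n * \<epsilon>" using \<epsilon> ex_less_of_nat_mult by blast
    show ?case
    proof (rule slab[OF insert.prems(1,2), of "- M" n])
      fix x assume "x \<in> K"
      then have "norm x \<le> \<bar>R\<bar>" using insert.prems(2) by (auto simp: K0_def)
      then have "norm x * norm b \<le> M" unfolding M_def by (intro mult_right_mono) auto
      then have "\<bar>x \<bullet> b\<bar> \<le> M" using Cauchy_Schwarz_ineq2[of x b] by linarith
      then show "- M \<le> x \<bullet> b \<and> x \<bullet> b \<le> - M + real n * \<epsilon>" using n by auto
    qed (use insert.prems(3) in auto)
  qed
  from this[of Basis K0] show ?thesis using K0cv by (simp add: K0_def)
qed

end

section \<open>Holonomy of linear loops\<close>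

lemma cis_eq_1_imp_int:
  assumes "cis (2 * pi * t) = 1"
  shows "t \<in> \<int>"
proof -
  have "cos (2 * pi * t) = 1" using assms by (simp add: complex_eq_iff)
  then obtain k :: int where "2 * pi * t = of_int k * 2 * pi" by (auto simp: cos_one_2pi_int)
  then show ?thesis by simp
qed

context connection_on_subtorus
begin

lemma segment_in_ball:
  assumes "x \<in> leaf" "w \<in> W" "norm x \<le> R" "norm (x + w) \<le> R" "t \<in> {0..1}"
  shows "x + t *\<^sub>R w \<in> leaf \<inter> cball 0 R"
proof -
  have "(1 - t) *\<^sub>R x + t *\<^sub>R (x + w) \<in> cball 0 R"
    using assms by (intro convexD[OF convex_cball]) auto
  also have "(1 - t) *\<^sub>R x + t *\<^sub>R (x + w) = x + t *\<^sub>R w"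
    by (simp add: algebra_simps)
  finally show ?thesis using assms leaf_add W_simps(4) by simp
qed

lemma chart_periodic:
  assumes "x \<in> chart i" "\<gamma> \<in> \<Lambda> \<inter> W"
  shows "x + \<gamma> \<in> chart i"
  using assms leaf_add proj_periodic by (simp add: chart_def)

text \<open>Along a line in direction \<open>\<gamma>\<close> the twisting form \<open>theta\<close> takes a constant value on \<open>\<gamma>\<close>, because
  \<open>F \<gamma> \<gamma> = 0\<close>; so a flat section becomes parallel for \<open>N\<close> after multiplication by an exponential.\<close>

lemma parallel_section_of_flat_section:
  assumes x: "x \<in> leaf" and \<gamma>: "\<gamma> \<in> W" and \<sigma>: "flat_section K \<sigma>"
    and K: "\<And>t. t \<in> {0..1} \<Longrightarrow> x + t *\<^sub>R \<gamma> \<in> K"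
  shows "parallel_section N (linear_loop (proj x) \<gamma>) (\<lambda>_. \<gamma>)
    (\<lambda>i t. \<sigma> i (x + t *\<^sub>R \<gamma>) * cis (pi * t * F (x - x0) \<gamma>))"
proof -
  have loop: "linear_loop (proj x) \<gamma> t = proj (x + t *\<^sub>R \<gamma>)" for t
    by (simp add: linear_loop_def shift_torus_proj)
  have ch: "x + t *\<^sub>R \<gamma> \<in> chart i" if "proj (x + t *\<^sub>R \<gamma>) \<in> patch N i" for t i
    using that x \<gamma> leaf_add W_simps(4) by (simp add: chart_def)
  have th: "theta (x + t *\<^sub>R \<gamma>) \<gamma> = - pi * F (x - x0) \<gamma>" for t
  proof -
    have "F (x - x0 + t *\<^sub>R \<gamma>) \<gamma> = F (x - x0) \<gamma>"
      using x \<gamma> by (simp add: F_add_left F_scale_left F_self W_simps leaf_def)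
    then show ?thesis by (simp add: theta_def algebra_simps)
  qed
  show ?thesis
    unfolding parallel_section_def loop
  proof (intro conjI ballI allI impI)
    fix t i j assume t: "t \<in> {0..1::real}" and p: "proj (x + t *\<^sub>R \<gamma>) \<in> patch N i \<inter> patch N j"
    then have "\<sigma> i (x + t *\<^sub>R \<gamma>) = trans N i j (proj (x + t *\<^sub>R \<gamma>)) * \<sigma> j (x + t *\<^sub>R \<gamma>)"
      by (intro flat_sectionD(2)[OF \<sigma> K]) (auto intro: ch)
    then show "\<sigma> i (x + t *\<^sub>R \<gamma>) * cis (pi * t * F (x - x0) \<gamma>) =
        trans N i j (proj (x + t *\<^sub>R \<gamma>)) * (\<sigma> j (x + t *\<^sub>R \<gamma>) * cis (pi * t * F (x - x0) \<gamma>))"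
      by simp
  next
    fix t i assume t: "t \<in> {0..1::real}" and p: "proj (x + t *\<^sub>R \<gamma>) \<in> patch N i"
    have "((\<lambda>t. pi * t * F (x - x0) \<gamma>) has_vector_derivative pi * F (x - x0) \<gamma>) (at t within {0..1})"
      by (auto intro!: derivative_eq_intros)
    from has_vector_derivative_mult[OF flat_section_along_segment[OF \<sigma> K \<gamma> t ch[OF p]] has_vector_derivative_cis[OF this]]
    show "((\<lambda>t. \<sigma> i (x + t *\<^sub>R \<gamma>) * cis (pi * t * F (x - x0) \<gamma>)) has_vector_derivative
        - potential N i (proj (x + t *\<^sub>R \<gamma>)) \<gamma> * (\<sigma> i (x + t *\<^sub>R \<gamma>) * cis (pi * t * F (x - x0) \<gamma>)))
        (at t within {0..1})"
      unfolding th potential_conn[OF ch[OF p] \<gamma>] by (simp add: algebra_simps)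
  qed
qed

text \<open>Every parallel section along the loop is a multiple of the one obtained from \<open>\<sigma>\<close>, so all of them
  are multiplied by the same number, and this one, which has no zeros, determines that number. The
  number is the same in all frames at \<open>x\<close>, because the transition functions live on the torus and
  agree at \<open>x\<close> and \<open>x + \<gamma>\<close>.\<close>

lemma loop_holonomy_flat_section:
  assumes x: "x \<in> leaf" and \<gamma>: "\<gamma> \<in> \<Lambda> \<inter> W" and \<sigma>: "flat_section K \<sigma>"
    and K: "\<And>t. t \<in> {0..1} \<Longrightarrow> x + t *\<^sub>R \<gamma> \<in> K" and i: "x \<in> chart i"
  shows "loop_holonomy N (proj x) \<gamma> = \<sigma> i (x + \<gamma>) / \<sigma> i x * cis (pi * F (x - x0) \<gamma>)"
proof -
  define c where "c = linear_loop (proj x) \<gamma>"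
  define s0 where "s0 i t = \<sigma> i (x + t *\<^sub>R \<gamma>) * cis (pi * t * F (x - x0) \<gamma>)" for i t
  define z where "z = \<sigma> i (x + \<gamma>) / \<sigma> i x * cis (pi * F (x - x0) \<gamma>)"
  have s0: "parallel_section N c (\<lambda>_. \<gamma>) s0"
    using parallel_section_of_flat_section[OF x _ \<sigma> K] \<gamma> by (simp add: c_def s0_def[abs_def])
  have c: "c t = proj (x + t *\<^sub>R \<gamma>)" for t
    by (simp add: c_def linear_loop_def shift_torus_proj)
  have seg: "x + t *\<^sub>R \<gamma> \<in> leaf" for t
    using x \<gamma> leaf_add W_simps(4) by simp
  have nz: "s0 j t \<noteq> 0" if "t \<in> {0..1}" "x + t *\<^sub>R \<gamma> \<in> chart j" for j t
    using flat_sectionD(1)[OF \<sigma> K that(2)] that(1) by (auto simp: s0_def)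
  have s0z: "s0 j 1 = z * s0 j 0" if j: "x \<in> chart j" for j
  proof -
    have "x \<in> K" "x + \<gamma> \<in> K" using K[of 0] K[of 1] by auto
    then have "\<sigma> j x = trans N j i (proj x) * \<sigma> i x"
      "\<sigma> j (x + \<gamma>) = trans N j i (proj (x + \<gamma>)) * \<sigma> i (x + \<gamma>)"
      using flat_sectionD(2)[OF \<sigma>] i j chart_periodic[OF _ \<gamma>] by blast+
    moreover have "\<sigma> i x \<noteq> 0" using nz[of 0 i] i by (simp add: s0_def)
    ultimately show ?thesis
      using \<gamma> by (simp add: s0_def z_def proj_periodic)
  qed
  have z: "s j 1 = z * s j 0" if s: "parallel_section N c (\<lambda>_. \<gamma>) s" and j: "c 0 \<in> patch N j" for s j
  proof -
    have in_patch: "c t \<in> patch N j" if "x + t *\<^sub>R \<gamma> \<in> chart j" for t j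
      using that by (simp add: c chart_def)
    obtain k where k: "\<And>i t. t \<in> {0..1} \<Longrightarrow> x + t *\<^sub>R \<gamma> \<in> chart i \<Longrightarrow> s i t = k * s0 i t"
    proof (rule parallel_sections_proportional[where I="\<lambda>i. {t. x + t *\<^sub>R \<gamma> \<in> chart i}"
          and s=s0 and s'=s
          and l="\<lambda>i t. - potential N i (c t) \<gamma>" and g="\<lambda>i j t. trans N i j (c t)"], goal_cases)
      case (1 t i)
      then show ?case using eventually_chart_segment \<gamma> by simp
    next
      case (2 t)
      then show ?case using chart_cover[OF seg] by simp
    next
      case (3 i j t)
      then show ?case using s0 in_patch unfolding parallel_section_def by blast
    next
      case (4 i j t)
      then show ?case using s in_patch unfolding parallel_section_def by blast
    next
      case (5 i t)
      then show ?case using nz by simp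
    next
      case (6 i t)
      then show ?case using s0 in_patch unfolding parallel_section_def by blast
    next
      case (7 i t)
      then show ?case using s in_patch unfolding parallel_section_def by blast
    next
      case (8 k)
      then show ?case by (intro 8(1)[of k] 8(2)) auto
    qed
    have "x \<in> chart j" using j x by (simp add: c chart_def)
    then show ?thesis
      using k[of 0 j] k[of 1 j] s0z[of j] chart_periodic[OF _ \<gamma>] by simp
  qed
  have "holonomy N c (\<lambda>_. \<gamma>) = z"
    unfolding holonomy_def
  proof (rule the_equality)
    show "\<forall>s. parallel_section N c (\<lambda>_. \<gamma>) s \<longrightarrow> (\<forall>i. c 0 \<in> patch N i \<longrightarrow> s i 1 = z * s i 0)"
      using z by blast
    fix z' assume "\<forall>s. parallel_section N c (\<lambda>_. \<gamma>) s \<longrightarrow> (\<forall>i. c 0 \<in> patch N i \<longrightarrow> s i 1 = z' * s i 0)"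
    moreover have "c 0 \<in> patch N i" using i by (simp add: c chart_def)
    ultimately have "s0 i 1 = z' * s0 i 0" using s0 by blast
    then show "z' = z" using s0z[OF i] nz[of 0 i] i by simp
  qed
  then show ?thesis by (simp add: loop_holonomy_def c_def z_def)
qed

lemma norm_loop_holonomy:
  assumes x: "x \<in> leaf" and \<gamma>: "\<gamma> \<in> \<Lambda> \<inter> W"
  shows "norm (loop_holonomy N (proj x) \<gamma>) = 1"
proof -
  define R where "R = max (norm x) (norm (x + \<gamma>))"
  obtain \<sigma> where \<sigma>: "flat_section (leaf \<inter> cball 0 R) \<sigma>" using flat_section_exists by blast
  have seg: "x + t *\<^sub>R \<gamma> \<in> leaf \<inter> cball 0 R" if "t \<in> {0..1}" for t
    using segment_in_ball[OF x _ _ _ that, of \<gamma> R] \<gamma> by (simp add: R_def)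
  obtain i where i: "x \<in> chart i" using chart_cover[OF x] by blast
  have "norm (\<sigma> i x) = 1" "norm (\<sigma> i (x + \<gamma>)) = 1"
    using flat_sectionD(1)[OF \<sigma> _ i] flat_sectionD(1)[OF \<sigma> _ chart_periodic[OF i \<gamma>]] seg[of 0] seg[of 1] by auto
  then show ?thesis
    using loop_holonomy_flat_section[OF x \<gamma> \<sigma> seg i] by (simp add: norm_mult norm_divide)
qed

text \<open>Stokes' theorem for the parallelogram spanned by \<open>w\<close> and \<open>\<gamma>\<close>. The translate of a flat
  section by \<open>\<gamma>\<close>, corrected by an exponential, satisfies the same equation along the segment
  from \<open>x\<close> to \<open>x + w\<close> as the flat section itself.\<close>

lemma loop_holonomy_translate:
  assumes x: "x \<in> leaf" and w: "w \<in> W" and \<gamma>: "\<gamma> \<in> \<Lambda> \<inter> W"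
  shows "loop_holonomy N (proj (x + w)) \<gamma> = loop_holonomy N (proj x) \<gamma> * cis (2 * pi * F w \<gamma>)"
proof -
  define R where "R = Max {norm x, norm (x + w), norm (x + \<gamma>), norm (x + w + \<gamma>)}"
  have R: "norm x \<le> R" "norm (x + w) \<le> R" "norm (x + \<gamma>) \<le> R" "norm (x + w + \<gamma>) \<le> R"
    by (auto simp: R_def)
  define K where "K = leaf \<inter> cball 0 R"
  obtain \<sigma> where \<sigma>: "flat_section K \<sigma>" using flat_section_exists by (auto simp: K_def)
  have \<gamma>W: "\<gamma> \<in> W" using \<gamma> by simp
  have segw: "x + t *\<^sub>R w \<in> K" if "t \<in> {0..1}" for t
    using segment_in_ball[OF x w R(1,2) that] by (simp add: K_def)
  have segw': "(x + \<gamma>) + t *\<^sub>R w \<in> K" if "t \<in> {0..1}" for t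
    using segment_in_ball[OF leaf_add[OF x \<gamma>W] w R(3) _ that] R(4) by (simp add: K_def add_ac)
  have xw: "x + t *\<^sub>R w - x0 \<in> W" for t
    using leaf_add[OF x W_simps(4)[OF w]] by (simp add: leaf_def)
  have per: "proj ((x + \<gamma>) + t *\<^sub>R w) = proj (x + t *\<^sub>R w)" for t
    using proj_periodic[of \<gamma> "x + t *\<^sub>R w"] \<gamma> by (simp add: add_ac)
  have ch: "(x + \<gamma>) + t *\<^sub>R w \<in> chart i" if "x + t *\<^sub>R w \<in> chart i" for t i
    using chart_periodic[OF that \<gamma>] by (simp add: add_ac)
  have conn: "conn i ((x + \<gamma>) + t *\<^sub>R w) u = conn i (x + t *\<^sub>R w) u" for i t u
    by (simp add: conn_def per)
  have th: "theta ((x + \<gamma>) + t *\<^sub>R w) w = theta (x + t *\<^sub>R w) w - pi * F \<gamma> w" for t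
  proof -
    have "F ((x + t *\<^sub>R w - x0) + \<gamma>) w = F (x + t *\<^sub>R w - x0) w + F \<gamma> w"
      using xw \<gamma>W w by (intro F_add_left)
    then show ?thesis by (simp add: theta_def algebra_simps)
  qed
  define s' where "s' i t = \<sigma> i ((x + \<gamma>) + t *\<^sub>R w) * cis (pi * t * F \<gamma> w)" for i t
  obtain k where k: "\<And>i t. t \<in> {0..1} \<Longrightarrow> x + t *\<^sub>R w \<in> chart i \<Longrightarrow> s' i t = k * \<sigma> i (x + t *\<^sub>R w)"
  proof (rule parallel_sections_proportional[where I="\<lambda>i. {t. x + t *\<^sub>R w \<in> chart i}"
        and s="\<lambda>i t. \<sigma> i (x + t *\<^sub>R w)" and s'=s'
        and l="\<lambda>i t. \<i> * of_real (theta (x + t *\<^sub>R w) w - conn i (x + t *\<^sub>R w) w)"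
        and g="\<lambda>i j t. trans N i j (proj (x + t *\<^sub>R w))"], goal_cases)
    case (1 t i)
    then show ?case using eventually_chart_segment[OF _ w] by simp
  next
    case (2 t)
    then show ?case using chart_cover[of "x + t *\<^sub>R w"] segw by (simp add: K_def)
  next
    case (3 i j t)
    then show ?case by (intro flat_sectionD(2)[OF \<sigma> segw]) auto
  next
    case (4 i j t)
    then have "\<sigma> i ((x + \<gamma>) + t *\<^sub>R w) = trans N i j (proj ((x + \<gamma>) + t *\<^sub>R w)) * \<sigma> j ((x + \<gamma>) + t *\<^sub>R w)"
      by (intro flat_sectionD(2)[OF \<sigma> segw'] ch) auto
    then show ?case by (simp add: s'_def per)
  next
    case (5 i t)
    then show ?case using flat_sectionD(1)[OF \<sigma> segw, of t i] by auto
  next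
    case (6 i t)
    then show ?case using flat_section_along_segment[OF \<sigma> segw w] by simp
  next
    case (7 i t)
    have "((\<lambda>t. pi * t * F \<gamma> w) has_vector_derivative pi * F \<gamma> w) (at t within {0..1})"
      by (auto intro!: derivative_eq_intros)
    note d = has_vector_derivative_mult[OF flat_section_along_segment[OF \<sigma> segw' w] has_vector_derivative_cis[OF this]]
    show ?case
      using d[of i] 7 ch[of t i] unfolding s'_def th conn by (simp add: algebra_simps)
  next
    case (8 k)
    then show ?case by (intro 8(1)[of k] 8(2)) auto
  qed
  obtain i where i: "x \<in> chart i" using chart_cover[OF x] by blast
  obtain j where j: "x + w \<in> chart j" using chart_cover[OF leaf_add[OF x w]] by blast
  have nz: "\<sigma> i x \<noteq> 0" "\<sigma> j (x + w) \<noteq> 0"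
    using flat_sectionD(1)[OF \<sigma> _ i] flat_sectionD(1)[OF \<sigma> _ j] segw[of 0] segw[of 1] by auto
  have h1: "loop_holonomy N (proj x) \<gamma> = k * cis (pi * F (x - x0) \<gamma>)"
  proof -
    have "x + t *\<^sub>R \<gamma> \<in> K" if "t \<in> {0..1}" for t
      using segment_in_ball[OF x \<gamma>W R(1,3) that] by (simp add: K_def)
    from loop_holonomy_flat_section[OF x \<gamma> \<sigma> this i] show ?thesis
      using k[of 0 i] i nz by (simp add: s'_def)
  qed
  have "loop_holonomy N (proj (x + w)) \<gamma> = \<sigma> j (x + w + \<gamma>) / \<sigma> j (x + w) * cis (pi * F (x + w - x0) \<gamma>)"
  proof -
    have "x + w + t *\<^sub>R \<gamma> \<in> K" if "t \<in> {0..1}" for t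
      using segment_in_ball[OF leaf_add[OF x w] \<gamma>W R(2,4) that] by (simp add: K_def)
    from loop_holonomy_flat_section[OF leaf_add[OF x w] \<gamma> \<sigma> this j] show ?thesis .
  qed
  also have "\<sigma> j (x + w + \<gamma>) / \<sigma> j (x + w) = k * cis (pi * F w \<gamma>)"
  proof -
    have "\<sigma> j (x + w + \<gamma>) * cis (- (pi * F w \<gamma>)) = k * \<sigma> j (x + w)"
      using k[of 1 j] j F_skew[OF \<gamma>W w] by (simp add: s'_def add_ac)
    then have "\<sigma> j (x + w + \<gamma>) * cis (- (pi * F w \<gamma>)) * cis (pi * F w \<gamma>) = k * \<sigma> j (x + w) * cis (pi * F w \<gamma>)"
      by simp
    then have "\<sigma> j (x + w + \<gamma>) = k * \<sigma> j (x + w) * cis (pi * F w \<gamma>)"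
      by (simp add: mult.assoc cis_mult)
    then show ?thesis using nz by simp
  qed
  also have "F (x + w - x0) \<gamma> = F (x - x0) \<gamma> + F w \<gamma>"
    using F_add_left[of "x - x0" w \<gamma>] x w \<gamma>W by (simp add: leaf_def algebra_simps)
  finally show ?thesis
    by (simp add: h1 cis_mult algebra_simps mult.assoc)
qed

text \<open>Translating a loop by a period does not change it, so the factor \<open>cis (2 * pi * F \<gamma> \<gamma>')\<close> by which the
  translation multiplies the holonomy is \<open>1\<close>.\<close>

lemma F_integral:
  assumes "\<gamma> \<in> \<Lambda> \<inter> W" "\<gamma>' \<in> \<Lambda> \<inter> W"
  shows "F \<gamma> \<gamma>' \<in> \<int>"
proof -
  have x0: "x0 \<in> leaf" by (simp add: leaf_def W_simps)
  have "loop_holonomy N (proj x0) \<gamma>' * cis (2 * pi * F \<gamma> \<gamma>') = loop_holonomy N (proj x0) \<gamma>'"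
    using loop_holonomy_translate[OF x0 _ assms(2), of \<gamma>] assms by (simp add: proj_periodic)
  moreover have "loop_holonomy N (proj x0) \<gamma>' \<noteq> 0"
    using norm_loop_holonomy[OF x0 assms(2)] by auto
  ultimately show ?thesis by (intro cis_eq_1_imp_int) simp
qed

text \<open>The quotient \<open>\<sigma>(x + \<gamma>' + \<gamma>)/\<sigma>(x)\<close> splits at \<open>x + \<gamma>'\<close>, a point over the same point of the torus as
  \<open>x\<close>. The twisting form differs at the two points, and its change is the correction.\<close>

lemma loop_holonomy_add:
  assumes x: "x \<in> leaf" and \<gamma>: "\<gamma> \<in> \<Lambda> \<inter> W" and \<gamma>': "\<gamma>' \<in> \<Lambda> \<inter> W"
  shows "loop_holonomy N (proj x) (\<gamma> + \<gamma>') =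
    loop_holonomy N (proj x) \<gamma> * loop_holonomy N (proj x) \<gamma>' * cis (pi * F \<gamma> \<gamma>')"
proof -
  have W: "\<gamma> \<in> W" "\<gamma>' \<in> W" using \<gamma> \<gamma>' by auto
  have sum: "\<gamma> + \<gamma>' \<in> \<Lambda> \<inter> W"
    using \<gamma> \<gamma>' add_subgroupD(4)[OF add_subgroup_full_lattice[OF lattice]] W_simps(2) by blast
  define R where "R = Max {norm x, norm (x + \<gamma>'), norm (x + \<gamma>' + \<gamma>)}"
  have R: "norm x \<le> R" "norm (x + \<gamma>') \<le> R" "norm (x + \<gamma>' + \<gamma>) \<le> R"
    by (auto simp: R_def)
  define K where "K = leaf \<inter> cball 0 R"
  obtain \<sigma> where \<sigma>: "flat_section K \<sigma>" using flat_section_exists by (auto simp: K_def)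
  obtain i where i: "x \<in> chart i" using chart_cover[OF x] by blast
  have i': "x + \<gamma>' \<in> chart i" using chart_periodic[OF i \<gamma>'] .
  have s1: "x + t *\<^sub>R \<gamma>' \<in> K" if "t \<in> {0..1}" for t
    using segment_in_ball[OF x W(2) R(1,2) that] by (simp add: K_def)
  have s2: "x + \<gamma>' + t *\<^sub>R \<gamma> \<in> K" if "t \<in> {0..1}" for t
    using segment_in_ball[OF leaf_add[OF x W(2)] W(1) R(2,3) that] by (simp add: K_def)
  have s3: "x + t *\<^sub>R (\<gamma> + \<gamma>') \<in> K" if "t \<in> {0..1}" for t
    using segment_in_ball[OF x _ R(1) _ that, of "\<gamma> + \<gamma>'"] R(3) W_simps(2)[OF W] by (simp add: K_def add_ac)
  have nz: "\<sigma> i (x + \<gamma>') \<noteq> 0"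
    using flat_sectionD(1)[OF \<sigma> _ i'] s2[of 0] by auto
  have "loop_holonomy N (proj x) \<gamma> = loop_holonomy N (proj (x + \<gamma>')) \<gamma>"
    using \<gamma>' by (simp add: proj_periodic)
  also have "\<dots> = \<sigma> i (x + \<gamma>' + \<gamma>) / \<sigma> i (x + \<gamma>') * cis (pi * F (x + \<gamma>' - x0) \<gamma>)"
    by (rule loop_holonomy_flat_section[OF leaf_add[OF x W(2)] \<gamma> \<sigma> s2 i'])
  also have "F (x + \<gamma>' - x0) \<gamma> = F (x - x0) \<gamma> - F \<gamma> \<gamma>'"
    using F_add_left[of "x - x0" \<gamma>' \<gamma>] F_skew[OF W] x W by (simp add: leaf_def algebra_simps)
  finally have 1: "loop_holonomy N (proj x) \<gamma> =
    \<sigma> i (x + \<gamma>' + \<gamma>) / \<sigma> i (x + \<gamma>') * cis (pi * (F (x - x0) \<gamma> - F \<gamma> \<gamma>'))" .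
  have 2: "loop_holonomy N (proj x) \<gamma>' = \<sigma> i (x + \<gamma>') / \<sigma> i x * cis (pi * F (x - x0) \<gamma>')"
    by (rule loop_holonomy_flat_section[OF x \<gamma>' \<sigma> s1 i])
  have 3: "loop_holonomy N (proj x) (\<gamma> + \<gamma>') = \<sigma> i (x + \<gamma>' + \<gamma>) / \<sigma> i x * cis (pi * (F (x - x0) \<gamma> + F (x - x0) \<gamma>'))"
    using loop_holonomy_flat_section[OF x sum \<sigma> s3 i] F_add_right[OF W, of "x - x0"] x
    by (simp add: leaf_def add_ac)
  have "cis (pi * (F (x - x0) \<gamma> - F \<gamma> \<gamma>')) * cis (pi * F (x - x0) \<gamma>') * cis (pi * F \<gamma> \<gamma>') =
      cis (pi * (F (x - x0) \<gamma> + F (x - x0) \<gamma>'))"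
    by (simp add: cis_mult algebra_simps)
  then show ?thesis
    unfolding 1 2 3 using nz by (simp add: mult_ac)
qed

end

section \<open>Local structure of the lift\<close>

lemma minus_one_pow_add: "minus_one_pow (a + b) = minus_one_pow a * minus_one_pow b"
  by (cases a; cases b) (auto simp: minus_one_pow_def)

lemma minus_one_pow_of_int: "minus_one_pow (of_int k) = cis (pi * of_int k)"
proof -
  have two: "(2 :: bit) = 0" using bit_numeral_even by auto
  have "even k \<Longrightarrow> (of_int k :: bit) = 0" and "odd k \<Longrightarrow> (of_int k :: bit) = 1"
    by (auto elim!: evenE oddE simp: two)
  moreover have "even k \<Longrightarrow> cis (pi * of_int k) = 1" "odd k \<Longrightarrow> cis (pi * of_int k) = - 1"
    by (auto simp: complex_eq_iff cos_npi_int sin_npi_int)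
  ultimately show ?thesis by (cases "even k") (auto simp: minus_one_pow_def)
qed

text \<open>The common tangent space of the lift at all of its points.\<close>

definition lift_tangent :: "'a::real_normed_vector set \<Rightarrow> ('a \<Rightarrow> 'a \<Rightarrow> real) \<Rightarrow> ('a \<times> ('a \<Rightarrow>\<^sub>L real)) set" where
  "lift_tangent W F = {(u, g). u \<in> W \<and> (\<forall>w\<in>W. blinfun_apply g w = F u w)}"

context connection_on_subtorus
begin

lemma lattice_W_subgroup: "add_subgroup (\<Lambda> \<inter> W)"
  using add_subgroup_full_lattice[OF lattice] W_simps by (auto simp: add_subgroup_def)

definition lift_character :: "('a \<Rightarrow> bit) \<Rightarrow> 'a set \<Rightarrow> 'a \<Rightarrow> complex" where
  "lift_character \<xi> p \<gamma> = minus_one_pow (\<xi> \<gamma>) * loop_holonomy N p \<gamma>"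

text \<open>The failure of \<open>\<xi>\<close> to be additive cancels the factor \<open>cis (\<pi> F \<gamma> \<gamma>')\<close> in the holonomy of a
  sum, which is a sign because \<open>F \<gamma> \<gamma>'\<close> is an integer.\<close>

lemma lift_character_hom:
  assumes \<xi>: "lift_sign_function \<Lambda> W F \<xi>" and x: "x \<in> leaf" and \<gamma>: "\<gamma> \<in> \<Lambda> \<inter> W" "\<gamma>' \<in> \<Lambda> \<inter> W"
  shows "lift_character \<xi> (proj x) (\<gamma> + \<gamma>') = lift_character \<xi> (proj x) \<gamma> * lift_character \<xi> (proj x) \<gamma>'"
proof -
  obtain k :: int where k: "F \<gamma> \<gamma>' = of_int k"
    using F_integral[OF \<gamma>] by (auto simp: Ints_def)
  have "\<xi> (\<gamma> + \<gamma>') - \<xi> \<gamma> - \<xi> \<gamma>' = of_int k"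
    using \<xi> \<gamma> k by (simp add: lift_sign_function_def chern_number_def)
  then have "\<xi> (\<gamma> + \<gamma>') = \<xi> \<gamma> + \<xi> \<gamma>' + of_int k"
    by (metis add.commute diff_add_cancel add.assoc)
  then have "minus_one_pow (\<xi> (\<gamma> + \<gamma>')) = minus_one_pow (\<xi> \<gamma>) * minus_one_pow (\<xi> \<gamma>') * cis (pi * F \<gamma> \<gamma>')"
    by (simp only: minus_one_pow_add minus_one_pow_of_int k)
  moreover have "cis (pi * F \<gamma> \<gamma>') * cis (pi * F \<gamma> \<gamma>') = 1"
  proof -
    have "cis (2 * pi * of_int k) = 1" by (rule cis_multiple_2pi) simp
    moreover have "pi * F \<gamma> \<gamma>' + pi * F \<gamma> \<gamma>' = 2 * pi * of_int k" by (simp add: k)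
    ultimately show ?thesis by (simp only: cis_mult)
  qed
  ultimately show ?thesis
    unfolding lift_character_def loop_holonomy_add[OF x \<gamma>] by (simp add: mult_ac)
qed

lemma norm_lift_character:
  assumes "x \<in> leaf" "\<gamma> \<in> \<Lambda> \<inter> W"
  shows "norm (lift_character \<xi> (proj x) \<gamma>) = 1"
  using norm_loop_holonomy[OF assms] by (simp add: lift_character_def norm_mult minus_one_pow_def)

lemma lift_character_translate:
  assumes "x \<in> leaf" "w \<in> W" "\<gamma> \<in> \<Lambda> \<inter> W"
  shows "lift_character \<xi> (proj (x + w)) \<gamma> =
    lift_character \<xi> (proj x) \<gamma> * exp (2 * of_real pi * \<i> * of_real (F w \<gamma>))"
  using loop_holonomy_translate[OF assms] by (simp add: lift_character_def cis_conv_exp mult_ac)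

lemma in_brane_lift_iff:
  "doubling_proj \<Lambda> (v, f) \<in> brane_lift \<Lambda> C W N \<xi> \<longleftrightarrow> proj v \<in> C \<and>
    (\<forall>\<gamma>\<in>\<Lambda> \<inter> W. exp (2 * of_real pi * \<i> * of_real (blinfun_apply f \<gamma>)) = lift_character \<xi> (proj v) \<gamma>)"
  by (auto simp: doubling_proj_def brane_lift_def torus_def lift_character_def dual_pairing_torus_proj)

lemma brane_lift_range: "brane_lift \<Lambda> C W N \<xi> \<subseteq> range (doubling_proj \<Lambda>)"
  by (force simp: brane_lift_def torus_def doubling_proj_def)

text \<open>Over any point of \<open>C\<close>, a point of the lift is a functional whose exponential is the character
  \<open>lift_character\<close>.\<close>

lemma brane_lift_nonempty:
  assumes "lift_sign_function \<Lambda> W F \<xi>"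
  shows "brane_lift \<Lambda> C W N \<xi> \<noteq> {}"
proof -
  have x0: "x0 \<in> leaf" by (simp add: leaf_def W_simps)
  obtain f where "\<And>\<gamma>. \<gamma> \<in> \<Lambda> \<inter> W \<Longrightarrow>
      lift_character \<xi> (proj x0) \<gamma> = exp (2 * of_real pi * \<i> * of_real (blinfun_apply f \<gamma>))"
    using lattice_character_exp[OF lattice lattice_W_subgroup, of "lift_character \<xi> (proj x0)"]
      norm_lift_character[OF x0] lift_character_hom[OF assms x0] by auto
  then have "doubling_proj \<Lambda> (x0, f) \<in> brane_lift \<Lambda> C W N \<xi>"
    using proj_leaf[OF x0] by (simp add: in_brane_lift_iff)
  then show ?thesis by blast
qed

lemma subspace_lift_tangent: "subspace (lift_tangent W F)"
  unfolding subspace_def lift_tangent_def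
  by (auto simp: W_simps F_add_left F_scale_left blinfun.add_left blinfun.scaleR_left zero_prod_def)
    (use F_scale_left[of 0 _ 0] W_simps(1) in auto)

lemma closed_lift_tangent: "closed (lift_tangent W F)"
proof -
  have "\<forall>w\<in>W. \<exists>g. bounded_linear g \<and> (\<forall>u\<in>W. g u = F u w)"
    using F_extends by metis
  then obtain g where g: "\<And>w. w \<in> W \<Longrightarrow> bounded_linear (g w)" "\<And>w u. w \<in> W \<Longrightarrow> u \<in> W \<Longrightarrow> g w u = F u w"
    by metis
  have "lift_tangent W F = (fst -` W) \<inter> (\<Inter>w\<in>W. {p. blinfun_apply (snd p) w = g w (fst p)})"
    by (auto simp: lift_tangent_def g(2))
  also have "closed \<dots>"
  proof (intro closed_Int closed_INT ballI)
    show "closed (fst -` W :: ('a \<times> ('a \<Rightarrow>\<^sub>L real)) set)"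
      by (intro closed_vimage closed_subspace subspace_W continuous_intros)
    fix w assume w: "w \<in> W"
    have "continuous_on UNIV (\<lambda>p. g w (fst p))"
      using g(1)[OF w] by (intro bounded_linear.continuous_on[of "g w"] continuous_intros) auto
    then show "closed {p. blinfun_apply (snd p) w = g w (fst p)}"
      by (intro closed_Collect_eq continuous_intros)
  qed
  finally show ?thesis .
qed

lemma brane_lift_translate:
  assumes "doubling_proj \<Lambda> e \<in> brane_lift \<Lambda> C W N \<xi>" "d \<in> lift_tangent W F"
  shows "doubling_proj \<Lambda> (e + d) \<in> brane_lift \<Lambda> C W N \<xi>"
proof -
  obtain v f where e: "e = (v, f)" by (cases e)
  obtain u g where d: "d = (u, g)" "u \<in> W" "\<And>w. w \<in> W \<Longrightarrow> blinfun_apply g w = F u w"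
    using assms(2) by (auto simp: lift_tangent_def)
  have "proj v \<in> C" using assms(1) by (simp add: e in_brane_lift_iff)
  then obtain w where w: "w \<in> W" "proj v = proj (x0 + w)"
    unfolding C_eq by blast
  define x where "x = x0 + w"
  have x: "x \<in> leaf" "proj v = proj x" using w by (auto simp: x_def leaf_def)
  have vu: "proj (v + u) = proj (x + u)"
    using x(2) by (metis shift_torus_proj)
  have "exp (2 * of_real pi * \<i> * of_real (blinfun_apply (f + g) \<gamma>)) = lift_character \<xi> (proj (v + u)) \<gamma>"
    if \<gamma>: "\<gamma> \<in> \<Lambda> \<inter> W" for \<gamma>
  proof -
    have "exp (2 * of_real pi * \<i> * of_real (blinfun_apply (f + g) \<gamma>)) =
        exp (2 * of_real pi * \<i> * of_real (blinfun_apply f \<gamma>)) * exp (2 * of_real pi * \<i> * of_real (F u \<gamma>))"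
      using d(3)[of \<gamma>] \<gamma> by (simp add: blinfun.add_left algebra_simps exp_add)
    then show ?thesis
      using assms(1) \<gamma> by (simp add: e in_brane_lift_iff vu x(2) lift_character_translate[OF x(1) d(2) \<gamma>])
  qed
  then show ?thesis
    using proj_leaf[OF leaf_add[OF x(1) d(2)]] by (simp add: e d in_brane_lift_iff vu)
qed

text \<open>A displacement between nearby points of the lift is small, so the integers by which it fails to
  be tangent vanish: the lattice vector that separates the base points from \<open>W\<close>, and
  \<open>g \<gamma> - F u \<gamma>\<close> for \<open>\<gamma>\<close> in a lattice basis of \<open>W\<close>.\<close>

lemma brane_lift_displacement:
  assumes rational: "span (\<Lambda> \<inter> W) = W"
  obtains r where "r > 0" "\<And>e d. doubling_proj \<Lambda> e \<in> brane_lift \<Lambda> C W N \<xi> \<Longrightarrow>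
    doubling_proj \<Lambda> (e + d) \<in> brane_lift \<Lambda> C W N \<xi> \<Longrightarrow> norm d < r \<Longrightarrow> d \<in> lift_tangent W F"
proof -
  note sg = add_subgroup_full_lattice[OF lattice]
  obtain r1 where r1: "r1 > 0" "\<And>w l. w \<in> W \<Longrightarrow> l \<in> \<Lambda> \<Longrightarrow> norm (w + l) < r1 \<Longrightarrow> l \<in> W"
    using rational_subspace_isolated[OF lattice subspace_W rational] by blast
  obtain B where B: "B \<subseteq> \<Lambda> \<inter> W" "independent B" "span B = W"
    using maximal_independent_subset[of "\<Lambda> \<inter> W"] rational
    by (metis span_subspace subset_trans inf_le2 span_mono span_span subset_antisym)
  then have fB: "finite B" using independent_bound by blast
  have "\<forall>w\<in>W. \<exists>M. \<forall>u\<in>W. \<bar>F u w\<bar> \<le> norm u * M"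
  proof
    fix w assume "w \<in> W"
    then obtain g where g: "bounded_linear g" "\<And>u. u \<in> W \<Longrightarrow> g u = F u w"
      using F_extends by blast
    obtain M where "\<And>u. norm (g u) \<le> norm u * M" using bounded_linear.bounded[OF g(1)] by blast
    then show "\<exists>M. \<forall>u\<in>W. \<bar>F u w\<bar> \<le> norm u * M" using g(2) by (metis real_norm_def)
  qed
  then obtain M where M: "\<And>u w. u \<in> W \<Longrightarrow> w \<in> W \<Longrightarrow> \<bar>F u w\<bar> \<le> norm u * M w" by metis
  \<comment> \<open>If \<open>u\<close> and \<open>g\<close> have norm less than \<open>1 / m\<close>, then \<open>g b - F u b\<close> has absolute value less than \<open>1\<close>.\<close>
  define m where "m = 1 + (\<Sum>b\<in>B. norm b + \<bar>M b\<bar>)"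
  have m: "m > 0" "\<And>b. b \<in> B \<Longrightarrow> norm b + \<bar>M b\<bar> < m"
    using member_le_sum[OF _ _ fB, of _ "\<lambda>b. norm b + \<bar>M b\<bar>"] sum_nonneg[of B "\<lambda>b. norm b + \<bar>M b\<bar>"]
    by (force simp: m_def)+
  have "d \<in> lift_tangent W F"
    if S: "doubling_proj \<Lambda> e \<in> brane_lift \<Lambda> C W N \<xi>" "doubling_proj \<Lambda> (e + d) \<in> brane_lift \<Lambda> C W N \<xi>"
      and n: "norm d < min r1 (1 / m)" for e d
  proof -
    obtain v f where e: "e = (v, f)" by (cases e)
    obtain u g where d: "d = (u, g)" by (cases d)
    have nu: "norm u < r1" "norm u < 1 / m" and ng: "norm g < 1 / m"
      using n norm_fst_le[of u g] norm_snd_le[of g u] by (auto simp: d)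
    have "proj v \<in> C" "proj (v + u) \<in> C"
      using S by (simp_all add: e d in_brane_lift_iff)
    then obtain w w' where w: "w \<in> W" "proj v = proj (x0 + w)"
      and w': "w' \<in> W" "proj (v + u) = proj (x0 + w')"
      unfolding C_eq by blast
    define x where "x = x0 + w"
    have x: "x \<in> leaf" "proj v = proj x" using w by (auto simp: x_def leaf_def)
    have u: "u \<in> W"
    proof -
      define l where "l = (v + u - (x0 + w')) - (v - (x0 + w))"
      have l: "l \<in> \<Lambda>"
        using w(2) w'(2) add_subgroupD(2)[OF sg, of "v + u - (x0 + w')" "v - (x0 + w)"]
        unfolding torus_proj_eq_iff[OF sg] l_def by blast
      have eq: "u = (w' - w) + l" by (simp add: l_def algebra_simps)
      then have "l \<in> W" using r1(2)[OF W_simps(3)[OF w'(1) w(1)] l] nu by simp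
      then show ?thesis using eq w(1) w'(1) W_simps by metis
    qed
    have vu: "proj (v + u) = proj (x + u)"
      using x(2) by (metis shift_torus_proj)
    have gB: "blinfun_apply g b - F u b = 0" if b: "b \<in> B" for b
    proof -
      have bW: "b \<in> \<Lambda> \<inter> W" using b B(1) by blast
      have "exp (2 * of_real pi * \<i> * of_real (blinfun_apply f b)) * exp (2 * of_real pi * \<i> * of_real (blinfun_apply g b))
          = exp (2 * of_real pi * \<i> * of_real (blinfun_apply f b)) * exp (2 * of_real pi * \<i> * of_real (F u b))"
      proof -
        have "exp (2 * of_real pi * \<i> * of_real (blinfun_apply f b)) = lift_character \<xi> (proj x) b"
          "exp (2 * of_real pi * \<i> * of_real (blinfun_apply (f + g) b)) = lift_character \<xi> (proj (x + u)) b"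
          using S bW unfolding e d add_Pair in_brane_lift_iff vu x(2) by blast+
        moreover have "exp (2 * of_real pi * \<i> * of_real (blinfun_apply (f + g) b)) =
          exp (2 * of_real pi * \<i> * of_real (blinfun_apply f b)) * exp (2 * of_real pi * \<i> * of_real (blinfun_apply g b))"
          by (simp add: blinfun.add_left distrib_left exp_add)
        ultimately show ?thesis
          using lift_character_translate[OF x(1) u bW, of \<xi>] by simp
      qed
      then have "exp (2 * of_real pi * \<i> * of_real (blinfun_apply g b)) = exp (2 * of_real pi * \<i> * of_real (F u b))"
        by simp
      then have "cis (2 * pi * (blinfun_apply g b - F u b)) = 1"
        by (simp add: cis_conv_exp algebra_simps exp_diff)
      then have int: "blinfun_apply g b - F u b \<in> \<int>" by (rule cis_eq_1_imp_int)
      have "\<bar>blinfun_apply g b\<bar> \<le> norm g * norm b" using norm_blinfun[of g b] by simp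
      also have "\<dots> \<le> (1 / m) * norm b" using ng by (intro mult_right_mono) auto
      finally have 1: "\<bar>blinfun_apply g b\<bar> \<le> (1 / m) * norm b" .
      have "\<bar>F u b\<bar> \<le> norm u * M b" using M[OF u] bW by blast
      also have "\<dots> \<le> norm u * \<bar>M b\<bar>" by (intro mult_left_mono) auto
      also have "\<dots> \<le> (1 / m) * \<bar>M b\<bar>" using nu by (intro mult_right_mono) auto
      finally have 2: "\<bar>F u b\<bar> \<le> (1 / m) * \<bar>M b\<bar>" .
      have "\<bar>blinfun_apply g b - F u b\<bar> \<le> (1 / m) * (norm b + \<bar>M b\<bar>)"
        using 1 2 by (simp add: algebra_simps)
      also have "\<dots> < (1 / m) * m" using m(1) m(2)[OF b] by (intro mult_strict_left_mono) auto
      finally have "\<bar>blinfun_apply g b - F u b\<bar> < 1" using m(1) by simp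
      then show ?thesis using int Ints_nonzero_abs_less1 by blast
    qed
    have "y \<in> W \<and> blinfun_apply g y = F u y" if "y \<in> span B" for y
      using that
    proof (induction rule: span_induct_alt)
      case base
      show ?case using F_scale_right[OF W_simps(1) u, of 0] W_simps(1) by simp
    next
      case (step c b y)
      then have "b \<in> W" using B(1) by blast
      then show ?case
        using step gB[OF step(1)] u
        by (simp add: W_simps F_add_right F_scale_right blinfun.add_right blinfun.scaleR_right)
    qed
    then show ?thesis using u B(3) by (simp add: d lift_tangent_def)
  qed
  then show ?thesis using that[of "min r1 (1 / m)"] r1(1) m(1) by auto
qed

end

lemma doubling_proj_locally_inj:
  fixes \<Lambda> :: "'a::euclidean_space set"
  assumes "full_lattice \<Lambda>"
  obtains r where "r > 0" "\<And>e. inj_on (doubling_proj \<Lambda>) (ball e r)"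
proof -
  obtain r1 where r1: "r1 > 0" "\<And>l. l \<in> \<Lambda> \<Longrightarrow> norm l < r1 \<Longrightarrow> l = 0"
    using full_lattice_discrete[OF assms] by blast
  obtain r2 where r2: "r2 > 0" "\<And>f. f \<in> dual_lattice \<Lambda> \<Longrightarrow> norm f < r2 \<Longrightarrow> f = 0"
    using dual_lattice_discrete[OF assms] by blast
  define r where "r = min r1 r2 / 2"
  have "inj_on (doubling_proj \<Lambda>) (ball e r)" for e
  proof (rule inj_onI)
    fix p p' assume p: "p \<in> ball e r" "p' \<in> ball e r" and eq: "doubling_proj \<Lambda> p = doubling_proj \<Lambda> p'"
    have "dist p p' \<le> dist e p + dist e p'" by (metis dist_commute dist_triangle)
    then have d: "norm (p - p') < min r1 r2" using p by (simp add: r_def dist_norm)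
    then have "norm (fst (p - p')) < r1" "norm (snd (p - p')) < r2"
      using norm_fst_le[of "fst (p - p')" "snd (p - p')"] norm_snd_le[of "snd (p - p')" "fst (p - p')"]
      unfolding prod.collapse by linarith+
    moreover have "fst p - fst p' \<in> \<Lambda>" "snd p - snd p' \<in> dual_lattice \<Lambda>"
      using eq iffD1[OF torus_proj_eq_iff[OF add_subgroup_full_lattice[OF assms]]]
        iffD1[OF torus_proj_eq_iff[OF add_subgroup_dual_lattice]]
      unfolding doubling_proj_def split_beta prod.inject by blast+
    ultimately have "fst p - fst p' = 0" "snd p - snd p' = 0"
      using r1(2)[of "fst p - fst p'"] r2(2)[of "snd p - snd p'"] by (simp_all add: fst_diff snd_diff)
    then show "p = p'" by (simp add: prod_eq_iff)
  qed
  moreover have "r > 0" using r1 r2 by (simp add: r_def)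
  ultimately show ?thesis using that by blast
qed

section \<open>Subsets of a quotient that are locally affine\<close>

lemma has_vector_derivative_in_closed_subspace:
  fixes c :: "real \<Rightarrow> 'e::real_normed_vector"
  assumes L: "subspace L" "closed L" and c: "(c has_vector_derivative v) (at 0)"
    and ev: "\<forall>\<^sub>F t in nhds 0. c t - c 0 \<in> L"
  shows "v \<in> L"
proof -
  have lim: "((\<lambda>t. (1 / t) *\<^sub>R (c t - c 0)) \<longlongrightarrow> v) (at 0)"
  proof (rule LIM_zero_cancel, rule tendsto_norm_zero_cancel)
    have "((\<lambda>t. norm ((1 / norm (t - 0)) *\<^sub>R (c t - (c 0 + (t - 0) *\<^sub>R v)))) \<longlongrightarrow> 0) (at 0)"
      using c unfolding has_vector_derivative_def has_derivative_within
      by (intro tendsto_norm_zero) simp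
    then show "((\<lambda>t. norm ((1 / t) *\<^sub>R (c t - c 0) - v)) \<longlongrightarrow> 0) (at 0)"
    proof (rule Lim_transform_eventually)
      have "norm ((1 / norm (t - 0)) *\<^sub>R (c t - (c 0 + (t - 0) *\<^sub>R v))) = norm ((1 / t) *\<^sub>R (c t - c 0) - v)"
        if "t \<noteq> 0" for t
      proof -
        have "(1 / t) *\<^sub>R (c t - c 0) - v = (1 / t) *\<^sub>R (c t - (c 0 + t *\<^sub>R v))"
          using that by (simp add: algebra_simps)
        then show ?thesis by simp
      qed
      then show "\<forall>\<^sub>F t in at 0. norm ((1 / norm (t - 0)) *\<^sub>R (c t - (c 0 + (t - 0) *\<^sub>R v))) = norm ((1 / t) *\<^sub>R (c t - c 0) - v)"
        by (auto simp: eventually_at_filter)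
    qed
  qed
  show ?thesis
  proof (rule Lim_in_closed_set[OF L(2) _ _ lim])
    show "\<forall>\<^sub>F t in at 0. (1 / t) *\<^sub>R (c t - c 0) \<in> L"
      using ev subspace_scale[OF L(1)] by (auto simp: eventually_at_filter elim: eventually_mono)
  qed simp
qed

lemma has_vector_derivative_along_line_cong:
  fixes x v :: "'e::real_normed_vector" and f h :: "'e \<Rightarrow> 'f::real_normed_vector"
  assumes "open S" "x \<in> S" "\<And>y. y \<in> S \<Longrightarrow> f y = h y"
    and "((\<lambda>t. h (x + t *\<^sub>R v)) has_vector_derivative d) (at 0)"
  shows "((\<lambda>t. f (x + t *\<^sub>R v)) has_vector_derivative d) (at 0)"
proof (rule has_vector_derivative_transform_within_open[OF assms(4)])
  show "open ((\<lambda>t::real. x + t *\<^sub>R v) -` S)"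
    by (intro open_vimage assms(1) continuous_intros)
qed (use assms(2,3) in auto)

lemma Ck_on_const:
  fixes f :: "'e::real_normed_vector \<Rightarrow> 'f::real_normed_vector"
  assumes "open S"
  shows "(\<And>x. x \<in> S \<Longrightarrow> f x = c) \<Longrightarrow> Ck_on W S k f"
proof (induction k arbitrary: f c)
  case 0
  then show ?case by (simp add: continuous_on_cong[of S S f "\<lambda>_. c"])
next
  case (Suc k)
  have d: "((\<lambda>t. f (x + t *\<^sub>R v)) has_vector_derivative 0) (at 0)" if "x \<in> S" for x v
    by (rule has_vector_derivative_along_line_cong[OF assms that Suc.prems])
      (auto intro!: derivative_eq_intros)
  have "Ck_on W S k (dir_deriv v f)" for v
    by (rule Suc.IH[of _ 0]) (simp add: dir_deriv_def vector_derivative_at[OF d])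
  then show ?case
    using Suc.prems differentiableI_vector[OF d] by (simp add: continuous_on_cong[of S S f "\<lambda>_. c"])
qed

lemma smooth_along_translation:
  fixes f :: "'e::real_normed_vector \<Rightarrow> 'e"
  assumes "open S" and f: "\<And>x. x \<in> S \<Longrightarrow> f x = x + c"
  shows "smooth_along W S f"
  unfolding smooth_along_def
proof
  fix k
  have c: "continuous_on S f"
    by (rule continuous_on_eq[of _ "\<lambda>x. x + c"]) (auto intro!: continuous_intros simp: f)
  have d: "((\<lambda>t. f (x + t *\<^sub>R v)) has_vector_derivative v) (at 0)" if "x \<in> S" for x v
    by (rule has_vector_derivative_along_line_cong[OF assms(1) that f])
      (auto intro!: derivative_eq_intros)
  have "Ck_on W S k (dir_deriv v f)" for k v
    by (rule Ck_on_const[OF assms(1), of _ v]) (simp add: dir_deriv_def vector_derivative_at[OF d])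
  then show "Ck_on W S k f"
    using c differentiableI_vector[OF d] by (cases k) simp_all
qed

lemma slice_chart_translation:
  fixes e :: "'e::real_normed_vector"
  assumes L: "subspace L" and inj: "inj_on q (ball e r)"
    and S: "\<And>e'. e' \<in> ball e r \<Longrightarrow> q e' \<in> S \<longleftrightarrow> e' - e \<in> L"
  shows "slice_chart q S (ball e r) (\<lambda>x. x - e) L"
proof -
  let ?\<phi> = "\<lambda>x. x - e" and ?U = "ball e r"
  have inj\<phi>: "inj_on ?\<phi> ?U" by (simp add: inj_on_def)
  have o: "open (?\<phi> ` ?U)" by (rule open_translation_subtract) simp
  have "the_inv_into ?U ?\<phi> y = y + e" if "y \<in> ?\<phi> ` ?U" for y
    using that the_inv_into_f_f[OF inj\<phi>] by auto
  then have "smooth_along UNIV (?\<phi> ` ?U) (the_inv_into ?U ?\<phi>)"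
    by (rule smooth_along_translation[OF o])
  moreover have "smooth_along UNIV ?U ?\<phi>"
    by (rule smooth_along_translation[of _ _ "- e"]) auto
  ultimately show ?thesis
    using L inj inj\<phi> o S by (auto simp: slice_chart_def)
qed

text \<open>Translations are slice charts, and a differentiable curve in the subset through \<open>e\<close> stays in
  \<open>e + L\<close> for a short time, so its velocity lies in the closed subspace \<open>L\<close>.\<close>

locale locally_affine =
  fixes q :: "'e::real_normed_vector \<Rightarrow> 'x" and S :: "'x set" and L :: "'e set" and r :: real
  assumes L: "subspace L" "closed L" and r: "r > 0"
    and inj: "\<And>e. inj_on q (ball e r)"
    and S: "S \<noteq> {}" "S \<subseteq> range q"
    and affine: "\<And>e e'. q e \<in> S \<Longrightarrow> e' \<in> ball e r \<Longrightarrow> q e' \<in> S \<longleftrightarrow> e' - e \<in> L"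
begin

lemma slice_chart: "q e \<in> S \<Longrightarrow> slice_chart q S (ball e r) (\<lambda>x. x - e) L"
  using slice_chart_translation[OF L(1) inj affine] by blast

lemma submanifold: "submanifold q (dim L) S"
  unfolding submanifold_def
proof (intro conjI ballI S)
  fix p assume p: "p \<in> S"
  then obtain e where "q e = p" using S(2) by auto
  then show "\<exists>e U \<phi> M. q e = p \<and> e \<in> U \<and> slice_chart q S U \<phi> M \<and> dim M = dim L"
    using slice_chart[of e] p r by (intro exI[of _ e] exI[of _ "ball e r"]) auto
qed

lemma tangent_space:
  assumes e: "q e \<in> S"
  shows "tangent_space q S e = L"
proof (intro subset_antisym subsetI)
  fix v assume "v \<in> tangent_space q S e"
  then obtain c where c: "c 0 = e" "(c has_vector_derivative v) (at (0::real))" "\<forall>\<^sub>F t in nhds 0. q (c t) \<in> S"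
    by (auto simp: tangent_space_def)
  have "isCont c 0" using has_vector_derivative_continuous[OF c(2)] by simp
  then have "\<forall>\<^sub>F t in nhds 0. c t \<in> ball e r"
    using topological_tendstoD[of c "c 0" "nhds 0" "ball e r"] r
    by (simp add: c(1) isCont_def tendsto_nhds_iff flip: c(1))
  with c(3) have "\<forall>\<^sub>F t in nhds 0. c t - c 0 \<in> L"
    by eventually_elim (use affine[OF e] c(1) in auto)
  then show "v \<in> L"
    by (rule has_vector_derivative_in_closed_subspace[OF L c(2)])
next
  fix v assume v: "v \<in> L"
  have "open ((\<lambda>t::real. e + t *\<^sub>R v) -` ball e r)"
    by (intro open_vimage continuous_intros) auto
  then have "\<forall>\<^sub>F t in nhds (0::real). t \<in> (\<lambda>t. e + t *\<^sub>R v) -` ball e r"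
    using r by (intro eventually_nhds_in_open) auto
  then have "\<forall>\<^sub>F t in nhds (0::real). q (e + t *\<^sub>R v) \<in> S"
    by eventually_elim (use affine[OF e] subspace_scale[OF L(1) v] in auto)
  moreover have "((\<lambda>t. e + t *\<^sub>R v) has_vector_derivative v) (at 0)"
    by (auto intro!: derivative_eq_intros)
  ultimately show "v \<in> tangent_space q S e"
    unfolding tangent_space_def by (intro CollectI exI[of _ "\<lambda>t. e + t *\<^sub>R v"]) auto
qed

lemma lagrangian: "sympl_orth \<sigma> L = L \<Longrightarrow> lagrangian_submanifold q \<sigma> S"
  using submanifold by (auto simp: lagrangian_submanifold_def tangent_space)

lemma complex: "J ` L \<subseteq> L \<Longrightarrow> complex_submanifold q J S"
  unfolding complex_submanifold_def
proof (intro conjI S exI[of _ "dim L"] ballI)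
  fix p assume J: "J ` L \<subseteq> L" and p: "p \<in> S"
  then obtain e where e: "q e = p" using S(2) by auto
  have "\<exists>D. ((\<lambda>x. x - e) has_derivative D) (at x) \<and> (\<forall>v. D (J v) = J (D v))" for x
    by (intro exI[of _ "\<lambda>v. v"]) (auto intro!: derivative_eq_intros)
  then show "\<exists>e U \<phi> M. q e = p \<and> e \<in> U \<and> slice_chart q S U \<phi> M \<and> dim M = dim L \<and>
      (\<forall>x\<in>U. \<exists>D. (\<phi> has_derivative D) (at x) \<and> (\<forall>v. D (J v) = J (D v))) \<and> J ` M \<subseteq> M"
    using slice_chart[of e] p r e J
    by (intro exI[of _ e] exI[of _ "ball e r"] exI[of _ "\<lambda>x. x - e"] exI[of _ L]) auto
qed

end


section \<open>Linear symplectic geometry of the lift\<close>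

locale symplectic_space =
  fixes \<omega> :: "'a::euclidean_space \<Rightarrow> 'a \<Rightarrow> real"
  assumes symp: "symplectic_form \<omega>"
begin

lemma omega_bilinear: "bilinear \<omega>"
proof -
  have l: "\<omega> (a *\<^sub>R u + b *\<^sub>R v) w = a * \<omega> u w + b * \<omega> v w" for u v w a b
    using symp unfolding symplectic_form_def two_form_on_def by blast
  have s: "\<omega> u v = - \<omega> v u" for u v
    using symp unfolding symplectic_form_def two_form_on_def by blast
  have left: "linear (\<lambda>u. \<omega> u w)" for w
    using l[where a=1 and b=1 and w=w] l[where b=0 and w=w] by (auto intro!: linearI)
  have "(\<lambda>u. - \<omega> u w) = \<omega> w" for w
    using s by (intro ext) (rule s[symmetric])
  then have "linear (\<omega> w)" for w
    using linear_compose_neg[OF left[of w]] by simp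
  then show ?thesis
    unfolding bilinear_def using left by blast
qed

lemmas omega_simps =
  bilinear_ladd[OF omega_bilinear] bilinear_radd[OF omega_bilinear]
  bilinear_lneg[OF omega_bilinear] bilinear_rneg[OF omega_bilinear]
  bilinear_lsub[OF omega_bilinear] bilinear_rsub[OF omega_bilinear]

lemma omega_skew: "\<omega> u v = - \<omega> v u"
  using symp unfolding symplectic_form_def two_form_on_def by blast

lemma omega_represents:
  obtains A where "linear A" "bij A" "\<And>u v. \<omega> u v = A u \<bullet> v"
proof -
  define A where "A u = (\<Sum>b\<in>Basis. \<omega> u b *\<^sub>R b)" for u
  have ll: "linear (\<lambda>u. \<omega> u b)" "linear (\<omega> b)" for b
    using omega_bilinear by (auto simp: bilinear_def)
  have A: "linear A"
    unfolding A_def[abs_def]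
    by (rule linearI)
      (auto simp: linear_add[OF ll(1)] linear_scale[OF ll(1)] scaleR_add_left sum.distrib scaleR_sum_right)
  have eq: "\<omega> u v = A u \<bullet> v" for u v
  proof -
    have "\<omega> u v = \<omega> u (\<Sum>b\<in>Basis. (v \<bullet> b) *\<^sub>R b)" by (simp add: euclidean_representation)
    also have "\<dots> = A u \<bullet> v"
      by (simp add: A_def linear_sum[OF ll(2)] linear_scale[OF ll(2)] inner_sum_left inner_commute[of v] mult.commute)
    finally show ?thesis .
  qed
  have "inj A"
    unfolding linear_injective_0[OF A]
    using symp unfolding symplectic_form_def eq by (metis inner_zero_left)
  then have "bij A" using linear_injective_imp_surjective[OF A] by (simp add: bij_def)
  then show ?thesis using that A eq by blast
qed

lemma flat_apply: "blinfun_apply (flat \<omega> u) = \<omega> u"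
  using omega_bilinear
  by (auto simp: flat_def bilinear_def linear_conv_bounded_linear bounded_linear_Blinfun_apply)

lemma omega_sharp: "\<omega> (sharp \<omega> f) = blinfun_apply f"
proof -
  obtain A where A: "linear A" "bij A" "\<And>u v. \<omega> u v = A u \<bullet> v"
    using omega_represents by blast
  define g where "g = (\<Sum>b\<in>Basis. blinfun_apply f b *\<^sub>R b)"
  have "flat \<omega> (inv A g) = f"
  proof (rule blinfun_eqI)
    fix v
    have "blinfun_apply f v = blinfun_apply f (\<Sum>b\<in>Basis. (v \<bullet> b) *\<^sub>R b)"
      by (simp add: euclidean_representation)
    also have "\<dots> = g \<bullet> v"
      by (simp add: g_def blinfun.sum_right blinfun.scaleR_right inner_sum_left inner_commute[of v] mult.commute)
    finally show "blinfun_apply (flat \<omega> (inv A g)) v = blinfun_apply f v"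
      by (simp add: flat_apply A(3) bij_is_surj[OF A(2)] surj_f_inv_f)
  qed
  then have "flat \<omega> (sharp \<omega> f) = f"
    unfolding sharp_def by (metis f_inv_into_f rangeI)
  then show ?thesis using flat_apply by metis
qed

lemma omega_inject: "\<omega> u = \<omega> v \<Longrightarrow> u = v"
  using symp unfolding symplectic_form_def
  by (metis (no_types) bilinear_lsub[OF omega_bilinear] diff_self right_minus_eq)

text \<open>Representing \<open>\<omega>\<close> by an invertible map turns symplectic complements into orthogonal ones.\<close>

lemma sympl_orth_orth:
  assumes W: "subspace W"
  shows "sympl_orth \<omega> (sympl_orth \<omega> W) = W"
proof -
  obtain A where A: "linear A" "bij A" "\<And>u v. \<omega> u v = A u \<bullet> v"
    using omega_represents by blast
  have *: "u \<in> W" if u: "\<And>v. (\<And>w. w \<in> W \<Longrightarrow> \<omega> v w = 0) \<Longrightarrow> \<omega> u v = 0" for u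
  proof -
    have "u \<in> orthogonal_comp (orthogonal_comp W)"
    proof (clarsimp simp: orthogonal_comp_def orthogonal_def)
      fix y assume y: "\<forall>x\<in>W. x \<bullet> y = 0"
      obtain v where v: "y = A v" using A(2) by (metis bij_pointE)
      have "\<omega> u v = 0" using y by (intro u) (simp add: A(3) v inner_commute)
      then show "y \<bullet> u = 0" using omega_skew[of u v] by (simp add: A(3) v)
    qed
    then show ?thesis using orthogonal_comp_self[OF W] by simp
  qed
  show ?thesis
  proof
    show "sympl_orth \<omega> (sympl_orth \<omega> W) \<subseteq> W"
      using * by (auto simp: sympl_orth_def)
    show "W \<subseteq> sympl_orth \<omega> (sympl_orth \<omega> W)"
    proof (clarsimp simp: sympl_orth_def)
      fix x v assume "x \<in> W" "\<forall>w\<in>W. \<omega> v w = 0"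
      then show "\<omega> x v = 0" using omega_skew[of x v] by simp
    qed
  qed
qed

end

context symplectic_space
begin

lemma sharp_flat: "sharp \<omega> (flat \<omega> u) = u"
  by (rule omega_inject) (simp add: omega_sharp flat_apply)

lemma sharp_zero: "sharp \<omega> 0 = 0"
proof (rule omega_inject)
  show "\<omega> (sharp \<omega> 0) = \<omega> 0"
    by (auto simp: omega_sharp bilinear_lzero[OF omega_bilinear])
qed

context
  fixes \<Lambda> :: "'a set" and C :: "'a set set" and W :: "'a set"
    and N :: "('i, 'a) line_connection" and F :: "'a \<Rightarrow> 'a \<Rightarrow> real"
  assumes brane: "linear_coisotropic_brane \<Lambda> \<omega> C W N F"
begin

lemma brane_subspace: "subspace W"
  using brane by (simp add: linear_coisotropic_brane_def affine_subtorus_def)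

lemma brane_form: "two_form_on W F"
  using brane by (simp add: linear_coisotropic_brane_def)

lemmas brane_F_skew = two_form_on_skew[OF brane_form]
  and brane_F_add = two_form_on_add[OF brane_form]
  and brane_F_minus = two_form_on_scale[OF brane_form, of _ _ "- 1", simplified]

lemma iso_dirs_eq_sympl_orth: "iso_dirs \<omega> W = sympl_orth \<omega> W"
  using brane by (auto simp: linear_coisotropic_brane_def iso_dirs_def sympl_orth_def)

lemma brane_F_iso:
  assumes "k \<in> sympl_orth \<omega> W" "w \<in> W"
  shows "k \<in> W" "F k w = 0" "F w k = 0"
proof -
  show k: "k \<in> W" and Fk: "F k w = 0"
    using assms brane by (auto simp: linear_coisotropic_brane_def simp flip: iso_dirs_eq_sympl_orth)
  then show "F w k = 0" using brane_F_skew[OF assms(2) k] by simp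
qed

lemma reduction_class:
  assumes "u \<in> W"
  shows "{u + k | k. k \<in> iso_dirs \<omega> W} \<in> reduction \<omega> W" "u \<in> {u + k | k. k \<in> iso_dirs \<omega> W}"
proof -
  show "{u + k | k. k \<in> iso_dirs \<omega> W} \<in> reduction \<omega> W"
    using assms by (auto simp: reduction_def)
  have "0 \<in> iso_dirs \<omega> W"
    by (simp add: iso_dirs_def subspace_0[OF brane_subspace] bilinear_lzero[OF omega_bilinear])
  then show "u \<in> {u + k | k. k \<in> iso_dirs \<omega> W}" by force
qed

text \<open>Any representative of the image of the class of \<open>u\<close> under \<open>\<omega>\<inverse>F\<close> will do.\<close>

lemma omega_inv_F_exists:
  assumes u: "u \<in> W"
  obtains a where "a \<in> W" "\<And>w. w \<in> W \<Longrightarrow> \<omega> a w = F u w"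
proof -
  let ?X = "{u + k | k. k \<in> iso_dirs \<omega> W}"
  have "omega_inv_F \<omega> F W ?X \<in> reduction \<omega> W"
    using brane reduction_class(1)[OF u] by (simp add: linear_coisotropic_brane_def)
  then obtain a where a: "a \<in> W" "omega_inv_F \<omega> F W ?X = {a + k | k. k \<in> iso_dirs \<omega> W}"
    by (auto simp: reduction_def)
  then have "a \<in> omega_inv_F \<omega> F W ?X" using reduction_class(2)[OF a(1)] by blast
  then have "\<omega> a w = F u w" if "w \<in> W" for w
    using reduction_class(2)[OF u] that by (simp add: omega_inv_F_def)
  then show ?thesis using that a(1) by blast
qed

text \<open>Because \<open>F\<close> vanishes on \<open>iso_dirs \<omega> W\<close>, the vector \<open>a\<close> represents the image of the class of \<open>u\<close>
  under \<open>\<omega>\<inverse>F\<close>, and applying \<open>\<omega>\<inverse>F\<close> again leads to the class of \<open>-u\<close>.\<close>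

lemma omega_inv_F_square:
  assumes u: "u \<in> W" and a: "a \<in> W" "\<And>w. w \<in> W \<Longrightarrow> \<omega> a w = F u w" and w: "w \<in> W"
  shows "F a w = - \<omega> u w"
proof -
  let ?X = "{u + k | k. k \<in> iso_dirs \<omega> W}"
  have "a \<in> omega_inv_F \<omega> F W ?X"
    unfolding omega_inv_F_def iso_dirs_eq_sympl_orth
    using a brane_F_add[OF u] brane_F_iso by auto
  moreover have "omega_inv_F \<omega> F W (omega_inv_F \<omega> F W ?X) = uminus ` ?X"
    using brane reduction_class(1)[OF u] by (simp add: linear_coisotropic_brane_def)
  then have "- u \<in> omega_inv_F \<omega> F W (omega_inv_F \<omega> F W ?X)"
    using reduction_class(2)[OF u] by blast
  ultimately have "\<omega> (- u) w = F a w"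
    using w by (simp add: omega_inv_F_def)
  then show ?thesis by (simp add: omega_simps)
qed

text \<open>On the symplectic complement of \<open>W\<close> the functional \<open>g\<close> agrees with \<open>F(u, _)\<close>, which vanishes there.
  So \<open>sharp \<omega> g\<close> lies in the double complement, which is \<open>W\<close>, and it represents the image of the
  class of \<open>u\<close> under \<open>\<omega>\<inverse>F\<close>.\<close>

lemma sharp_lift_tangent:
  assumes "(u, g) \<in> lift_tangent W F"
  shows "sharp \<omega> g \<in> W" "\<And>w. w \<in> W \<Longrightarrow> F (sharp \<omega> g) w = - \<omega> u w"
proof -
  have u: "u \<in> W" and g: "\<And>w. w \<in> W \<Longrightarrow> \<omega> (sharp \<omega> g) w = F u w"
    using assms by (auto simp: lift_tangent_def omega_sharp)
  have "sharp \<omega> g \<in> sympl_orth \<omega> (sympl_orth \<omega> W)"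
    unfolding sympl_orth_def[of \<omega> "sympl_orth \<omega> W"] using g brane_F_iso u by auto
  then show a: "sharp \<omega> g \<in> W" by (simp add: sympl_orth_orth[OF brane_subspace])
  show "F (sharp \<omega> g) w = - \<omega> u w" if "w \<in> W" for w
    by (rule omega_inv_F_square[OF u a g that])
qed

lemma lift_tangent_complex: "doubling_J \<omega> ` lift_tangent W F \<subseteq> lift_tangent W F"
proof
  fix q assume "q \<in> doubling_J \<omega> ` lift_tangent W F"
  then obtain u g where q: "q = doubling_J \<omega> (u, g)" and "(u, g) \<in> lift_tangent W F" by auto
  from sharp_lift_tangent[OF this(2)] show "q \<in> lift_tangent W F"
    by (simp add: q doubling_J_def lift_tangent_def blinfun.minus_left flat_apply)
qed

text \<open>The form vanishes because \<open>\<omega>(a, b) = F(u, b) = -F(b, u) = \<omega>(v, u)\<close> for \<open>a = sharp \<omega> \<alpha>\<close> and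
  \<open>b = sharp \<omega> \<beta>\<close>. For maximality, pairing \<open>(u, \<alpha>)\<close> with \<open>(k, 0)\<close> for \<open>k\<close> in
  the symplectic complement of \<open>W\<close> gives \<open>u \<in> W\<close>, and pairing it with an element whose second
  component is \<open>flat \<omega> w\<close> computes \<open>\<alpha> w\<close>.\<close>

lemma lift_tangent_lagrangian: "sympl_orth (doubling_form \<omega>) (lift_tangent W F) = lift_tangent W F"
proof (intro subset_antisym subsetI)
  fix p assume p: "p \<in> lift_tangent W F"
  obtain u \<alpha> where p': "p = (u, \<alpha>)" by (cases p)
  have "doubling_form \<omega> (u, \<alpha>) (v, \<beta>) = 0" if q: "(v, \<beta>) \<in> lift_tangent W F" for v \<beta>
  proof -
    have u: "u \<in> W" using p by (simp add: p' lift_tangent_def)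
    have "blinfun_apply \<alpha> (sharp \<omega> \<beta>) = F u (sharp \<omega> \<beta>)"
      using p sharp_lift_tangent(1)[OF q] by (simp add: p' lift_tangent_def)
    also have "\<dots> = \<omega> v u"
      using brane_F_skew[OF u sharp_lift_tangent(1)[OF q]] sharp_lift_tangent(2)[OF q u] by simp
    finally show ?thesis using omega_skew[of v u] by (simp add: doubling_form_def)
  qed
  then show "p \<in> sympl_orth (doubling_form \<omega>) (lift_tangent W F)"
    by (auto simp: sympl_orth_def p')
next
  fix p assume p: "p \<in> sympl_orth (doubling_form \<omega>) (lift_tangent W F)"
  obtain u \<alpha> where p': "p = (u, \<alpha>)" by (cases p)
  have orth: "\<omega> u v + blinfun_apply \<alpha> (sharp \<omega> \<beta>) = 0" if "(v, \<beta>) \<in> lift_tangent W F" for v \<beta>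
  proof -
    have "doubling_form \<omega> (u, \<alpha>) (v, \<beta>) = 0"
      using p that by (auto simp: sympl_orth_def p')
    then show ?thesis by (simp add: doubling_form_def)
  qed
  have "u \<in> sympl_orth \<omega> (sympl_orth \<omega> W)"
    unfolding sympl_orth_def[of \<omega> "sympl_orth \<omega> W"]
  proof (intro CollectI ballI)
    fix k assume k: "k \<in> sympl_orth \<omega> W"
    have "(k, 0) \<in> lift_tangent W F"
      using brane_F_iso[OF k] subspace_0[OF brane_subspace] by (auto simp: lift_tangent_def)
    then show "\<omega> u k = 0" using orth[of k 0] by (simp add: sharp_zero)
  qed
  then have u: "u \<in> W" by (simp add: sympl_orth_orth[OF brane_subspace])
  have "blinfun_apply \<alpha> w = F u w" if w: "w \<in> W" for w
  proof -
    obtain a where a: "a \<in> W" "\<And>z. z \<in> W \<Longrightarrow> \<omega> a z = F w z"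
      using omega_inv_F_exists[OF w] by blast
    have "(- a, flat \<omega> w) \<in> lift_tangent W F"
      using omega_inv_F_square[OF w a] brane_F_minus[OF a(1)] subspace_neg[OF brane_subspace a(1)]
      by (simp add: lift_tangent_def flat_apply)
    then have "blinfun_apply \<alpha> w = \<omega> u a"
      using orth[of "- a" "flat \<omega> w"] by (simp add: sharp_flat omega_simps)
    also have "\<dots> = F u w"
      using omega_skew[of u a] a(2)[OF u] brane_F_skew[OF u w] by simp
    finally show ?thesis .
  qed
  then show "p \<in> lift_tangent W F" using u by (simp add: p' lift_tangent_def)
qed

end

end

theorem theorem1p2:
  fixes \<Lambda> :: "'a::euclidean_space set"
    and \<omega> F :: "'a \<Rightarrow> 'a \<Rightarrow> real"
    and C :: "'a set set" and W :: "'a set"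
    and N :: "('i, 'a) line_connection"
    and \<xi> :: "'a \<Rightarrow> bit"
    and n :: nat
  assumes "DIM('a) = 2 * n"
    and "full_lattice \<Lambda>"
    and "symplectic_form \<omega>"
    and "linear_coisotropic_brane \<Lambda> \<omega> C W N F"
    and "lift_sign_function \<Lambda> W F \<xi>"
  shows "lagrangian_submanifold (doubling_proj \<Lambda>) (doubling_form \<omega>) (brane_lift \<Lambda> C W N \<xi>) \<and>
         complex_submanifold (doubling_proj \<Lambda>) (doubling_J \<omega>) (brane_lift \<Lambda> C W N \<xi>)"
proof -
  interpret symplectic_space \<omega> by unfold_locales (rule assms(3))
  have torus: "affine_subtorus \<Lambda> C W"
    using assms(4) by (simp add: linear_coisotropic_brane_def)
  then obtain x0 where "C = {torus_proj \<Lambda> (x0 + w) | w. w \<in> W}"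
    by (auto simp: affine_subtorus_def)
  then interpret connection_on_subtorus \<Lambda> C W N F x0
    using assms(2,4) by unfold_locales (auto simp: linear_coisotropic_brane_def affine_subtorus_def)
  let ?q = "doubling_proj \<Lambda>" and ?S = "brane_lift \<Lambda> C W N \<xi>"
  obtain r1 where r1: "r1 > 0" "\<And>e. inj_on ?q (ball e r1)"
    using doubling_proj_locally_inj[OF assms(2)] by blast
  obtain r2 where r2: "r2 > 0"
    "\<And>e d. ?q e \<in> ?S \<Longrightarrow> ?q (e + d) \<in> ?S \<Longrightarrow> norm d < r2 \<Longrightarrow> d \<in> lift_tangent W F"
    using brane_lift_displacement torus unfolding affine_subtorus_def by metis
  interpret locally_affine ?q ?S "lift_tangent W F" "min r1 r2"
  proof
    fix e e' assume e: "?q e \<in> ?S" "e' \<in> ball e (min r1 r2)"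
    show "?q e' \<in> ?S \<longleftrightarrow> e' - e \<in> lift_tangent W F"
    proof
      assume "?q e' \<in> ?S"
      then show "e' - e \<in> lift_tangent W F"
        using e by (intro r2(2)[of e]) (auto simp: dist_norm norm_minus_commute)
    next
      assume "e' - e \<in> lift_tangent W F"
      then show "?q e' \<in> ?S" using brane_lift_translate[OF e(1)] by fastforce
    qed
  next
    show "inj_on ?q (ball e (min r1 r2))" for e
      by (rule inj_on_subset[OF r1(2)]) auto
  qed (use r1 r2 subspace_lift_tangent closed_lift_tangent brane_lift_nonempty[OF assms(5)] brane_lift_range in auto)
  show ?thesis
    using lagrangian[OF lift_tangent_lagrangian[OF assms(4)]] complex[OF lift_tangent_complex[OF assms(4)]] by blast
qed

end
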